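(* A cometric symmetric association scheme is uniform (with respect to some imprimitivity system) if and only if it is Q-antipodal.
   Context: A (symmetric) $d$-class association scheme $(X,\mathcal R)$, $|X|=v$, $\mathcal R=\{R_0,\dots,R_d\}$ ($R_0$ the diagonal, each $R_i$ symmetric, constant intersection numbers $p^h_{ij}$) has adjacency matrices $A_i$, Bose–Mesner algebra $\mathcal A=\langle A_i\rangle$, primitive idempotents $E_0=\frac1vJ,\dots,E_d$, and Krein parameters $q^h_{ij}$ defined by $E_i\circ E_j=\frac1v\sum_hq^h_{ij}E_h$. It is cometric (Q-polynomial) if there is an ordering $E_0,E_1,\dots,E_d$ with $q^h_{ij}=0$ whenever $h<|i-j|$ or $h>i+j$, and $q^{i+j}_{ij}>0$ whenever $i+j\le d$. It is Q-antipodal if it is cometric and, for such a Q-polynomial ordering, it is imprimitive with $\mathcal J=\{0,d\}$, i.e. $n(E_0+E_d)$ is the $0/1$ matrix of an equivalence relation on $X$ whose classes (fibres) have size $n$. Imprimitivity system: a partition of $X$ into $w$ fibres of size $n$ with index set $\mathcal I$ such that $\sum_{i\in\mathcal I}A_i$ is the $0/1$ matrix of "same fibre". For fibres $U,V$ let $\mathcal I(U,V)$ be the set of $i$ with $R_i\cap(U\times V)\neq\emptyset$ and $M^{UV}$ the matrix agreeing with $M$ on $U\times V$, zero elsewhere. The scheme is uniform (w.r.t. this system) if $\mathcal I(U,V)=\{0,\dots,d\}\setminus\mathcal I$ for all distinct fibres $U,V$, and there are integers $a^h_{ij}$ with $A_i^{UV}A_j^{VW}=\sum_h a^h_{ij}A_h^{UW}$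 for all fibres $U,V,W$ and $i\in\mathcal I(U,V),j\in\mathcal I(V,W)$. *)

theory Defs
  imports "HOL-Analysis.Analysis" "HOL-Library.Disjoint_Sets"
begin

text \<open>The point set of a scheme is the finite type \<open>'x\<close>; relations and idempotents
  are indexed by \<open>0, \<dots>, d\<close>, and values of the families beyond \<open>d\<close> are irrelevant.\<close>

definition assoc_scheme :: "nat \<Rightarrow> (nat \<Rightarrow> ('x::finite \<times> 'x) set) \<Rightarrow> bool" where
  "assoc_scheme d R \<longleftrightarrow>
     R 0 = Id \<and>
     (\<Union>i\<le>d. R i) = UNIV \<and>
     disjoint_family_on R {..d} \<and>
     (\<forall>i\<le>d. R i \<noteq> {}) \<and>
     (\<forall>i\<le>d. sym (R i)) \<and>
     (\<exists>p :: nat \<Rightarrow> nat \<Rightarrow> nat \<Rightarrow> nat. \<forall>h\<le>d. \<forall>i\<le>d. \<forall>j\<le>d. \<forall>(x, y)\<in>R h.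
        card {z. (x, z) \<in> R i \<and> (z, y) \<in> R j} = p h i j)"

definition rel_matrix :: "('x::finite \<times> 'x) set \<Rightarrow> real ^ 'x ^ 'x" where
  "rel_matrix S = (\<chi> x y. if (x, y) \<in> S then 1 else 0)"

definition bose_mesner :: "nat \<Rightarrow> (nat \<Rightarrow> ('x::finite \<times> 'x) set) \<Rightarrow> (real ^ 'x ^ 'x) set" where
  "bose_mesner d R = span ((\<lambda>i. rel_matrix (R i)) ` {..d})"

definition primitive_idempotent :: "(real ^ 'x ^ 'x) set \<Rightarrow> real ^ 'x ^ 'x::finite \<Rightarrow> bool" where
  "primitive_idempotent \<A> E \<longleftrightarrow>
     E \<in> \<A> \<and> E \<noteq> 0 \<and> E ** E = E \<and>
     \<not> (\<exists>F\<in>\<A>. \<exists>G\<in>\<A>. F \<noteq> 0 \<and> G \<noteq> 0 \<and> F ** F = F \<and> G ** G = G \<and>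
          F ** G = 0 \<and> G ** F = 0 \<and> E = F + G)"

definition idempotent_ordering ::
    "nat \<Rightarrow> (nat \<Rightarrow> ('x::finite \<times> 'x) set) \<Rightarrow> (nat \<Rightarrow> real ^ 'x ^ 'x) \<Rightarrow> bool" where
  "idempotent_ordering d R E \<longleftrightarrow>
     bij_betw E {..d} {F. primitive_idempotent (bose_mesner d R) F} \<and>
     E 0 = (\<chi> x y. 1 / real CARD('x))"

definition schur_product :: "real ^ 'x ^ 'x \<Rightarrow> real ^ 'x ^ 'x \<Rightarrow> real ^ 'x ^ 'x::finite" where
  "schur_product M N = (\<chi> x y. M $ x $ y * N $ x $ y)"

text \<open>\<open>q h i j\<close> is $q^h_{ij}$. The $E_h$ form a basis of the Bose--Mesner algebra, which is
  closed under the entrywise product, so such a \<open>q\<close> exists and is unique for indices up to \<open>d\<close>.\<close>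

definition krein_parameters ::
    "nat \<Rightarrow> (nat \<Rightarrow> real ^ 'x ^ 'x::finite) \<Rightarrow> (nat \<Rightarrow> nat \<Rightarrow> nat \<Rightarrow> real) \<Rightarrow> bool" where
  "krein_parameters d E q \<longleftrightarrow>
     (\<forall>i\<le>d. \<forall>j\<le>d. schur_product (E i) (E j) =
        (1 / real CARD('x)) *\<^sub>R (\<Sum>h\<le>d. q h i j *\<^sub>R E h))"

definition Q_polynomial_ordering ::
    "nat \<Rightarrow> (nat \<Rightarrow> ('x::finite \<times> 'x) set) \<Rightarrow> (nat \<Rightarrow> real ^ 'x ^ 'x) \<Rightarrow> bool" where
  "Q_polynomial_ordering d R E \<longleftrightarrow>
     idempotent_ordering d R E \<and>
     (\<exists>q. krein_parameters d E q \<and>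
        (\<forall>h\<le>d. \<forall>i\<le>d. \<forall>j\<le>d. int h < \<bar>int i - int j\<bar> \<or> h > i + j \<longrightarrow> q h i j = 0) \<and>
        (\<forall>i j. i + j \<le> d \<longrightarrow> q (i + j) i j > 0))"

definition cometric :: "nat \<Rightarrow> (nat \<Rightarrow> ('x::finite \<times> 'x) set) \<Rightarrow> bool" where
  "cometric d R \<longleftrightarrow> (\<exists>E. Q_polynomial_ordering d R E)"

definition same_fibre_matrix :: "'x::finite set set \<Rightarrow> real ^ 'x ^ 'x" where
  "same_fibre_matrix \<F> = rel_matrix {(x, y). \<exists>U\<in>\<F>. x \<in> U \<and> y \<in> U}"

text \<open>As usual for imprimitivity, the two trivial partitions (into singletons, and with a
  single fibre) are excluded: every scheme satisfies the uniformity condition for the partition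
  with a single fibre.\<close>

definition imprimitivity_system ::
    "nat \<Rightarrow> (nat \<Rightarrow> ('x::finite \<times> 'x) set) \<Rightarrow> nat \<Rightarrow> nat \<Rightarrow> 'x set set \<Rightarrow> nat set \<Rightarrow> bool" where
  "imprimitivity_system d R w n \<F> \<I> \<longleftrightarrow>
     partition_on UNIV \<F> \<and> card \<F> = w \<and> (\<forall>U\<in>\<F>. card U = n) \<and>
     w > 1 \<and> n > 1 \<and>
     \<I> \<subseteq> {..d} \<and> (\<Sum>i\<in>\<I>. rel_matrix (R i)) = same_fibre_matrix \<F>"

definition Q_antipodal :: "nat \<Rightarrow> (nat \<Rightarrow> ('x::finite \<times> 'x) set) \<Rightarrow> bool" where
  "Q_antipodal d R \<longleftrightarrow>
     (\<exists>E. Q_polynomial_ordering d R E \<and>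
        (\<exists>w n \<F> \<I>. imprimitivity_system d R w n \<F> \<I> \<and>
           real n *\<^sub>R (E 0 + E d) = same_fibre_matrix \<F>))"

definition fibre_indices ::
    "nat \<Rightarrow> (nat \<Rightarrow> ('x::finite \<times> 'x) set) \<Rightarrow> 'x set \<Rightarrow> 'x set \<Rightarrow> nat set" where
  "fibre_indices d R U V = {i. i \<le> d \<and> R i \<inter> (U \<times> V) \<noteq> {}}"

definition block :: "real ^ 'x ^ 'x \<Rightarrow> 'x set \<Rightarrow> 'x set \<Rightarrow> real ^ 'x ^ 'x::finite" where
  "block M U V = (\<chi> x y. if x \<in> U \<and> y \<in> V then M $ x $ y else 0)"

definition uniform_wrt ::
    "nat \<Rightarrow> (nat \<Rightarrow> ('x::finite \<times> 'x) set) \<Rightarrow> 'x set set \<Rightarrow> nat set \<Rightarrow> bool" where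
  "uniform_wrt d R \<F> \<I> \<longleftrightarrow>
     (\<forall>U\<in>\<F>. \<forall>V\<in>\<F>. U \<noteq> V \<longrightarrow> fibre_indices d R U V = {..d} - \<I>) \<and>
     (\<exists>a :: nat \<Rightarrow> nat \<Rightarrow> nat \<Rightarrow> int. \<forall>U\<in>\<F>. \<forall>V\<in>\<F>. \<forall>W\<in>\<F>.
        \<forall>i\<in>fibre_indices d R U V. \<forall>j\<in>fibre_indices d R V W.
          block (rel_matrix (R i)) U V ** block (rel_matrix (R j)) V W =
          (\<Sum>h\<le>d. real_of_int (a h i j) *\<^sub>R block (rel_matrix (R h)) U W))"

definition uniform_scheme :: "nat \<Rightarrow> (nat \<Rightarrow> ('x::finite \<times> 'x) set) \<Rightarrow> bool" where
  "uniform_scheme d R \<longleftrightarrow>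
     (\<exists>w n \<F> \<I>. imprimitivity_system d R w n \<F> \<I> \<and> uniform_wrt d R \<F> \<I>)"

end

theory Submission
  imports Defs
begin

text \<open>
  Let \<open>D\<^sub>U\<close> be the diagonal projection onto a fibre \<open>U\<close>, and call \<open>h\<close>, \<open>i\<close> similar if
  \<open>E\<^sub>h D\<^sub>U E\<^sub>i \<noteq> 0\<close> for some \<open>U\<close>. This is an equivalence relation whose class sums are the primitive
  idempotents of the block diagonal part of the Bose--Mesner algebra. If the same-fibre
  matrix is \<open>n (E\<^sub>0 + E\<^sub>j)\<close>, then distinct \<open>h\<close>, \<open>i\<close> are similar iff \<open>q\<^sup>h\<^sub>i\<^sub>j \<noteq> 0\<close>.

  For a Q-antipodal scheme (\<open>j = d\<close>) the classes are \<open>{i, d - i}\<close>, and for \<open>2 i < d\<close> one gets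
  \<open>E\<^sub>i D\<^sub>V E\<^sub>i = E\<^sub>i / w\<close>, which makes products of off-diagonal blocks independent of the middle
  fibre. Conversely, in a uniform scheme the quotient is trivial, so the same-fibre matrix is
  \<open>n (E\<^sub>0 + E\<^sub>j)\<close>, and similarity classes have at most two elements. If \<open>j < d\<close>, then
  \<open>1\<close>, \<open>j - 1\<close> and \<open>j + 1\<close> are similar, so \<open>j = 2\<close> and \<open>d = 3\<close>. There the Krein condition forces
  \<open>n = 2\<close> and \<open>E\<^sub>3\<close> of rank one, so that the scheme is Q-antipodal for a different system with two
  fibres.
\<close>

section \<open>Square matrices\<close>

text \<open>Supplies the rules \<open>matmul.add_left\<close>, \<open>matmul.sum_right\<close>,
  \<open>matmul.scaleR_left\<close> and so on, with which matrix products are expanded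
  below.\<close>

interpretation matmul: bounded_bilinear "(**) :: real^'n^'n::finite \<Rightarrow> real^'n^'n \<Rightarrow> real^'n^'n"
proof -
  have "bilinear ((**) :: real^'n^'n::finite \<Rightarrow> real^'n^'n \<Rightarrow> real^'n^'n)"
    by (auto simp: bilinear_def linear_iff matrix_matrix_mult_def vec_eq_iff sum.distrib
        algebra_simps sum_distrib_left)
  then show "bounded_bilinear ((**) :: real^'n^'n::finite \<Rightarrow> real^'n^'n \<Rightarrow> real^'n^'n)"
    by (simp add: bilinear_conv_bounded_bilinear)
qed

lemma inner_matrix_entries:
  fixes M N :: "real^'n^'n::finite"
  shows "M \<bullet> N = (\<Sum>x\<in>UNIV. \<Sum>y\<in>UNIV. M $ x $ y * N $ x $ y)"
  by (simp add: inner_vec_def)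

lemma inner_transpose:
  fixes M N :: "real^'n^'n::finite"
  shows "transpose M \<bullet> transpose N = M \<bullet> N"
  unfolding inner_matrix_entries transpose_def by (simp, subst sum.swap, simp)

text \<open>The inner product of \<open>real^'n^'n\<close> is the trace form, for which right
  multiplication by \<open>B\<close> has adjoint right multiplication by
  \<open>transpose B\<close>.\<close>

lemma inner_matmul_right:
  fixes A B C :: "real^'n^'n::finite"
  shows "(A ** B) \<bullet> C = A \<bullet> (C ** transpose B)"
proof -
  have "(A ** B) \<bullet> C = (\<Sum>x\<in>UNIV. \<Sum>y\<in>UNIV. \<Sum>z\<in>UNIV. A $ x $ z * B $ z $ y * C $ x $ y)"
    by (simp add: inner_matrix_entries matrix_matrix_mult_def sum_distrib_right)
  also have "\<dots> = (\<Sum>x\<in>UNIV. \<Sum>z\<in>UNIV. \<Sum>y\<in>UNIV. A $ x $ z * B $ z $ y * C $ x $ y)"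
    by (rule sum.cong[OF refl], rule sum.swap)
  also have "\<dots> = A \<bullet> (C ** transpose B)"
    by (simp add: inner_matrix_entries matrix_matrix_mult_def sum_distrib_left transpose_def mult_ac)
  finally show ?thesis .
qed

lemma inner_matmul_left:
  fixes A B C :: "real^'n^'n::finite"
  shows "(A ** B) \<bullet> C = B \<bullet> (transpose A ** C)"
proof -
  have "(A ** B) \<bullet> C = (transpose B ** transpose A) \<bullet> transpose C"
    by (metis inner_transpose matrix_transpose_mul)
  also have "\<dots> = transpose B \<bullet> (transpose C ** A)"
    by (simp add: inner_matmul_right)
  also have "\<dots> = B \<bullet> (transpose A ** C)"
    by (metis inner_transpose matrix_transpose_mul transpose_transpose)
  finally show ?thesis .
qed

lemma inner_mat_1:
  fixes M :: "real^'n^'n::finite"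
  shows "mat 1 \<bullet> M = (\<Sum>x\<in>UNIV. M $ x $ x)"
  by (simp add: inner_matrix_entries mat_def if_distrib[of "\<lambda>c. c * _"] cong: if_cong)

lemma inner_schur_product:
  "M \<bullet> schur_product N K = (\<Sum>x\<in>UNIV. \<Sum>y\<in>UNIV. M $ x $ y * N $ x $ y * K $ x $ y)"
  by (simp add: inner_matrix_entries schur_product_def mult_ac)

lemma schur_product_nth [simp]: "schur_product M N $ x $ y = M $ x $ y * N $ x $ y"
  by (simp add: schur_product_def)

lemma rel_matrix_nth [simp]: "rel_matrix S $ x $ y = (if (x, y) \<in> S then 1 else 0)"
  by (simp add: rel_matrix_def)

text \<open>The entrywise cube of \<open>M = M M\<^sup>T\<close> has nonnegative sum, since
  \<open>(\<Sum>\<^sub>a M\<^sub>x\<^sub>a M\<^sub>y\<^sub>a)\<^sup>3\<close> summed over \<open>x, y\<close> is a sum of squares over \<open>(a, b, c)\<close>.\<close>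

lemma sum_cubes_idempotent_nonneg:
  fixes M :: "real^'n^'n::finite"
  assumes idem: "M ** M = M" and sym: "transpose M = M"
  shows "(\<Sum>x\<in>UNIV. \<Sum>y\<in>UNIV. (M $ x $ y) ^ 3) \<ge> 0"
proof -
  have e: "M $ x $ y = (\<Sum>a\<in>UNIV. M $ x $ a * M $ y $ a)" for x y
  proof -
    have "M $ x $ y = (M ** M) $ x $ y" by (simp add: idem)
    also have "\<dots> = (\<Sum>a\<in>UNIV. M $ x $ a * M $ a $ y)" by (simp add: matrix_matrix_mult_def)
    also have "\<dots> = (\<Sum>a\<in>UNIV. M $ x $ a * transpose M $ a $ y)" by (simp only: sym)
    finally show ?thesis by (simp add: transpose_def)
  qed
  define f where "f x p = (case p of (a, b, c) \<Rightarrow> M $ x $ a * M $ x $ b * M $ x $ c)"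
    for x :: 'n and p :: "'n \<times> 'n \<times> 'n"
  have cube: "(M $ x $ y) ^ 3 = (\<Sum>p\<in>UNIV. f x p * f y p)" for x y
  proof -
    have "(M $ x $ y) ^ 3 = (\<Sum>a\<in>UNIV. M $ x $ a * M $ y $ a) *
       ((\<Sum>a\<in>UNIV. M $ x $ a * M $ y $ a) * (\<Sum>a\<in>UNIV. M $ x $ a * M $ y $ a))"
      by (subst e) (simp add: power3_eq_cube mult.assoc)
    also have "\<dots> = (\<Sum>p\<in>UNIV \<times> UNIV \<times> UNIV. f x p * f y p)"
      unfolding sum_product sum.cartesian_product f_def
      by (auto intro!: sum.cong simp: mult_ac)
    finally show ?thesis by simp
  qed
  have "(\<Sum>x\<in>UNIV. \<Sum>y\<in>UNIV. (M $ x $ y) ^ 3) = (\<Sum>x\<in>UNIV. \<Sum>p\<in>UNIV. \<Sum>y\<in>UNIV. f x p * f y p)"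
    unfolding cube by (rule sum.cong[OF refl], rule sum.swap)
  also have "\<dots> = (\<Sum>p\<in>UNIV. (\<Sum>x\<in>UNIV. f x p) * (\<Sum>y\<in>UNIV. f y p))"
    by (subst sum.swap) (simp add: sum_product)
  finally show ?thesis by (simp add: sum_nonneg)
qed

section \<open>The basis of primitive idempotents\<close>

locale ordered_scheme =
  fixes d :: nat and R :: "nat \<Rightarrow> ('x::finite \<times> 'x) set" and E :: "nat \<Rightarrow> real^'x^'x"
  assumes scheme: "assoc_scheme d R" and ordering: "idempotent_ordering d R E"
begin

abbreviation "BM \<equiv> bose_mesner d R"

section \<open>The Bose-Mesner algebra under the ordinary and the entrywise product\<close>

lemma relation_exists: obtains h where "h \<le> d" "(x, y) \<in> R h"
proof -
  have "(x, y) \<in> (\<Union>i\<le>d. R i)"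
    using scheme unfolding assoc_scheme_def by (metis UNIV_I)
  then show ?thesis using that by blast
qed

lemma relation_unique:
  assumes "(x, y) \<in> R h" "(x, y) \<in> R i" "h \<le> d" "i \<le> d" shows "h = i"
proof -
  have "disjoint_family_on R {..d}" using scheme unfolding assoc_scheme_def by metis
  then show ?thesis using assms unfolding disjoint_family_on_def by blast
qed

lemma relation_sym: "i \<le> d \<Longrightarrow> (x, y) \<in> R i \<Longrightarrow> (y, x) \<in> R i"
  using scheme unfolding assoc_scheme_def by (meson symD)

lemma relation_0: "(x, y) \<in> R 0 \<longleftrightarrow> x = y"
  using scheme unfolding assoc_scheme_def by (metis pair_in_Id_conv)

lemma sum_rel_matrix_nth:
  assumes "(x, y) \<in> R h" "h \<le> d" "J \<subseteq> {..d}"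
  shows "(\<Sum>i\<in>J. c i *\<^sub>R rel_matrix (R i)) $ x $ y = (if h \<in> J then c h else 0)"
proof -
  have "finite J" using assms(3) finite_subset by blast
  have "(\<Sum>i\<in>J. c i *\<^sub>R rel_matrix (R i)) $ x $ y = (\<Sum>i\<in>J. if i = h then c h else 0)"
    using assms relation_unique by (auto intro!: sum.cong)
  then show ?thesis using \<open>finite J\<close> by simp
qed

text \<open>The relations partition all pairs of points, so a linear combination of the
  \<open>rel_matrix (R i)\<close> can be read off entrywise. This form makes closure under
  \<open>schur_product\<close> immediate.\<close>

lemma BM_iff: "M \<in> BM \<longleftrightarrow> (\<exists>c. \<forall>i\<le>d. \<forall>x y. (x, y) \<in> R i \<longrightarrow> M $ x $ y = c i)"
proof
  assume "M \<in> BM"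
  then show "\<exists>c. \<forall>i\<le>d. \<forall>x y. (x, y) \<in> R i \<longrightarrow> M $ x $ y = c i"
    unfolding bose_mesner_def
  proof (induction rule: span_induct_alt)
    case base
    show ?case by (intro exI[of _ "\<lambda>_. 0"]) simp
  next
    case (step a S N)
    then obtain j c where "j \<le> d" "S = rel_matrix (R j)"
      "\<And>i x y. i \<le> d \<Longrightarrow> (x, y) \<in> R i \<Longrightarrow> N $ x $ y = c i" by auto
    then show ?case
      by (intro exI[of _ "\<lambda>i. c i + (if i = j then a else 0)"]) (auto dest: relation_unique)
  qed
next
  assume "\<exists>c. \<forall>i\<le>d. \<forall>x y. (x, y) \<in> R i \<longrightarrow> M $ x $ y = c i"
  then obtain c where c: "\<And>i x y. i \<le> d \<Longrightarrow> (x, y) \<in> R i \<Longrightarrow> M $ x $ y = c i" by blast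
  have "M = (\<Sum>i\<le>d. c i *\<^sub>R rel_matrix (R i))"
    unfolding vec_eq_iff
  proof (intro allI)
    fix x y
    obtain h where h: "h \<le> d" "(x, y) \<in> R h" by (rule relation_exists)
    then show "M $ x $ y = (\<Sum>i\<le>d. c i *\<^sub>R rel_matrix (R i)) $ x $ y"
      by (subst sum_rel_matrix_nth[OF h(2,1)]) (auto simp: c)
  qed
  also have "\<dots> \<in> BM"
    unfolding bose_mesner_def by (intro span_sum span_scale span_base) auto
  finally show "M \<in> BM" .
qed

lemma rel_matrix_in_BM: "i \<le> d \<Longrightarrow> rel_matrix (R i) \<in> BM"
  by (auto simp: bose_mesner_def intro: span_base)

lemma BM_subspace: "subspace BM"
  by (simp add: bose_mesner_def)

lemmas BM_closed [intro] =
  subspace_add[OF BM_subspace] subspace_diff[OF BM_subspace] subspace_scale[OF BM_subspace]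
  subspace_sum[OF BM_subspace]

lemma schur_in_BM: "M \<in> BM \<Longrightarrow> N \<in> BM \<Longrightarrow> schur_product M N \<in> BM"
  unfolding BM_iff by (clarsimp, rename_tac c e, rule_tac x = "\<lambda>i. c i * e i" in exI, simp)

lemma mat_1_in_BM: "mat 1 \<in> BM"
proof -
  have "mat 1 = rel_matrix (R 0)" by (simp add: vec_eq_iff mat_def relation_0)
  then show ?thesis by (simp add: rel_matrix_in_BM)
qed

lemma rel_matrix_mult_nth:
  "(rel_matrix S ** rel_matrix T) $ x $ y = real (card {z. (x, z) \<in> S \<and> (z, y) \<in> T})"
proof -
  have "(rel_matrix S ** rel_matrix T) $ x $ y
      = (\<Sum>z\<in>UNIV. if (x, z) \<in> S \<and> (z, y) \<in> T then 1 else 0)"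
    by (auto simp: matrix_matrix_mult_def intro!: sum.cong)
  also have "\<dots> = real (card {z. (x, z) \<in> S \<and> (z, y) \<in> T})"
    by (simp add: sum.If_cases)
  finally show ?thesis .
qed

text \<open>The intersection numbers are the entries of the product of two generators; the rest is
  span induction in each factor.\<close>

lemma mult_in_BM:
  assumes "M \<in> BM" "N \<in> BM" shows "M ** N \<in> BM"
proof -
  obtain p :: "nat \<Rightarrow> nat \<Rightarrow> nat \<Rightarrow> nat" where p: "\<forall>h\<le>d. \<forall>i\<le>d. \<forall>j\<le>d. \<forall>(x, y)\<in>R h.
      card {z. (x, z) \<in> R i \<and> (z, y) \<in> R j} = p h i j"
    using scheme unfolding assoc_scheme_def by (elim conjE exE)
  have gen: "rel_matrix (R i) ** rel_matrix (R j) \<in> BM" if "i \<le> d" "j \<le> d" for i j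
    unfolding BM_iff
  proof (intro exI[of _ "\<lambda>h. real (p h i j)"] allI impI)
    fix h x y assume "h \<le> d" "(x, y) \<in> R h"
    then have "card {z. (x, z) \<in> R i \<and> (z, y) \<in> R j} = p h i j"
      using p that by fast
    then show "(rel_matrix (R i) ** rel_matrix (R j)) $ x $ y = real (p h i j)"
      by (simp add: rel_matrix_mult_nth)
  qed
  have right: "rel_matrix (R i) ** N \<in> BM" if "i \<le> d" for i
    using \<open>N \<in> BM\<close> unfolding bose_mesner_def
  proof (induction rule: span_induct_alt)
    case base
    then show ?case by (simp add: span_zero)
  next
    case (step c S K)
    then have "rel_matrix (R i) ** S \<in> BM" using gen that by auto
    then show ?case using step
      by (simp add: matmul.add_right matmul.scaleR_right span_add span_scale bose_mesner_def)
  qed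
  show ?thesis
    using \<open>M \<in> BM\<close> unfolding bose_mesner_def
  proof (induction rule: span_induct_alt)
    case base
    then show ?case by (simp add: span_zero)
  next
    case (step c S K)
    then have "S ** N \<in> BM" using right by auto
    then show ?case using step
      by (simp add: matmul.add_left matmul.scaleR_left span_add span_scale bose_mesner_def)
  qed
qed

lemma transpose_BM: "M \<in> BM \<Longrightarrow> transpose M = M"
  unfolding BM_iff transpose_def vec_eq_iff
  by (auto, metis relation_exists relation_sym)

lemma BM_symmetric: "M \<in> BM \<Longrightarrow> M $ x $ y = M $ y $ x"
  using transpose_BM[of M] by (metis transpose_def vec_lambda_beta)

text \<open>All elements are symmetric, including the product, so transposing \<open>M ** N\<close>
  swaps the factors.\<close>

lemma BM_commute: "M \<in> BM \<Longrightarrow> N \<in> BM \<Longrightarrow> M ** N = N ** M"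
  by (metis matrix_transpose_mul mult_in_BM transpose_BM)

lemma BM_diag: "M \<in> BM \<Longrightarrow> M $ x $ x = M $ y $ y"
  unfolding BM_iff by (metis le0 relation_0)

section \<open>Orthogonality of the primitive idempotents and eigenvalues\<close>

lemma primitive_E: "i \<le> d \<Longrightarrow> primitive_idempotent BM (E i)"
  using ordering by (auto simp: idempotent_ordering_def bij_betw_def)

lemma E_in_BM: "i \<le> d \<Longrightarrow> E i \<in> BM"
  and E_nonzero: "i \<le> d \<Longrightarrow> E i \<noteq> 0"
  and E_idem: "i \<le> d \<Longrightarrow> E i ** E i = E i"
  using primitive_E by (auto simp: primitive_idempotent_def)

lemma E_inj: "i \<le> d \<Longrightarrow> j \<le> d \<Longrightarrow> E i = E j \<Longrightarrow> i = j"
  using ordering by (auto simp: idempotent_ordering_def bij_betw_def inj_on_def)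

lemma E_0_nth: "E 0 $ x $ y = 1 / real CARD('x)"
  using ordering by (simp add: idempotent_ordering_def)

lemma transpose_E: "i \<le> d \<Longrightarrow> transpose (E i) = E i"
  by (simp add: E_in_BM transpose_BM)

text \<open>Otherwise \<open>P\<close> would split into the nonzero orthogonal idempotents
  \<open>P ** Q\<close> and \<open>P - P ** Q\<close>.\<close>

lemma primitive_absorb:
  assumes "primitive_idempotent BM P" "primitive_idempotent BM Q" "P ** Q \<noteq> 0"
  shows "P ** Q = P"
proof (rule ccontr)
  assume ne: "P ** Q \<noteq> P"
  have PQ: "P \<in> BM" "Q \<in> BM" "P ** P = P" "Q ** Q = Q"
    using assms by (auto simp: primitive_idempotent_def)
  have c: "Q ** P = P ** Q" using PQ BM_commute by blast
  have i1: "(P ** Q) ** (P ** Q) = P ** Q"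
    by (metis PQ(3,4) c matrix_mul_assoc)
  have i2: "P ** (P ** Q) = P ** Q" "(P ** Q) ** P = P ** Q"
    by (metis PQ(3,4) c matrix_mul_assoc)+
  have "P ** Q \<in> BM" "P - P ** Q \<in> BM" using PQ mult_in_BM by auto
  moreover have "(P - P ** Q) ** (P - P ** Q) = P - P ** Q"
    "(P ** Q) ** (P - P ** Q) = 0" "(P - P ** Q) ** (P ** Q) = 0"
    by (simp_all add: matmul.diff_left matmul.diff_right i1 i2 PQ)
  moreover have "P = P ** Q + (P - P ** Q)" "P - P ** Q \<noteq> 0" using ne by auto
  ultimately show False
    using assms(1,3) i1 unfolding primitive_idempotent_def by blast
qed

lemma E_orthogonal: "i \<le> d \<Longrightarrow> j \<le> d \<Longrightarrow> i \<noteq> j \<Longrightarrow> E i ** E j = 0"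
  by (metis BM_commute E_in_BM E_inj primitive_E primitive_absorb)

lemma E_mult: "i \<le> d \<Longrightarrow> j \<le> d \<Longrightarrow> E i ** E j = (if i = j then E i else 0)"
  by (simp add: E_idem E_orthogonal)

lemma E_inner: "i \<le> d \<Longrightarrow> j \<le> d \<Longrightarrow> i \<noteq> j \<Longrightarrow> E i \<bullet> E j = 0"
  by (metis E_idem E_orthogonal inner_matmul_left inner_zero_right transpose_E)

text \<open>For \<open>i \<le> d\<close> this is the trace, and so the rank, of the symmetric
  idempotent \<open>E i\<close>: the multiplicity of the scheme.\<close>

definition mult_of :: "nat \<Rightarrow> real" where "mult_of i = E i \<bullet> E i"

lemma mult_pos: "i \<le> d \<Longrightarrow> mult_of i > 0"
  by (simp add: mult_of_def E_nonzero)

text \<open>For \<open>M\<close> in \<open>BM\<close> this is the eigenvalue of \<open>M\<close> on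
  the range of \<open>E i\<close>, see \<open>E_mult_BM\<close>. Defining it as a projection
  coefficient makes it linear on all matrices.\<close>

definition ev :: "real^'x^'x \<Rightarrow> nat \<Rightarrow> real" where "ev M i = (E i \<bullet> M) / mult_of i"

lemma ev_linear:
  "ev (M + N) i = ev M i + ev N i" "ev (M - N) i = ev M i - ev N i" "ev (c *\<^sub>R M) i = c * ev M i"
  by (simp_all add: ev_def inner_add_right inner_diff_right add_divide_distrib diff_divide_distrib)

lemma ev_E: "i \<le> d \<Longrightarrow> j \<le> d \<Longrightarrow> ev (E i) j = (if i = j then 1 else 0)"
  using mult_pos[of j] E_inner[of j i] by (auto simp: ev_def mult_of_def)

lemma ev_sum: "ev (sum f S) i = (\<Sum>j\<in>S. ev (f j) i)"
  by (simp add: ev_def inner_sum_right sum_divide_distrib)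

text \<open>Dimension count: \<open>E 0, ..., E d\<close> are \<open>d + 1\<close> orthogonal
  nonzero elements of a space spanned by \<open>d + 1\<close> matrices.\<close>

lemma E_image_span: "span (E ` {..d}) = BM"
proof -
  have inj: "inj_on E {..d}" using E_inj by (auto simp: inj_on_def)
  have "pairwise orthogonal (E ` {..d})"
    unfolding pairwise_def orthogonal_def using E_inner by blast
  moreover have "0 \<notin> E ` {..d}" using E_nonzero by auto
  ultimately have ind: "independent (E ` {..d})"
    by (rule pairwise_orthogonal_independent)
  have "dim BM \<le> card ((\<lambda>i. rel_matrix (R i)) ` {..d})"
    unfolding bose_mesner_def dim_span by (rule dim_le_card') simp
  also have "\<dots> \<le> card {..d}" by (rule card_image_le) simp
  also have "\<dots> = card (E ` {..d})" by (simp add: card_image inj)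
  finally have "BM \<subseteq> span (E ` {..d})"
    using card_ge_dim_independent[OF _ ind] E_in_BM by blast
  moreover have "span (E ` {..d}) \<subseteq> BM"
    using E_in_BM by (intro span_minimal BM_subspace) auto
  ultimately show ?thesis by blast
qed

lemma BM_expand:
  assumes "M \<in> BM" shows "M = (\<Sum>i\<le>d. ev M i *\<^sub>R E i)"
proof -
  have "M \<in> span (E ` {..d})" using assms E_image_span by simp
  then show ?thesis
  proof (induction rule: span_induct_alt)
    case base
    then show ?case by (simp add: ev_def)
  next
    case (step c S N)
    then obtain j where j: "j \<le> d" "S = E j" by auto
    have "(\<Sum>i\<le>d. ev (c *\<^sub>R S + N) i *\<^sub>R E i)
        = c *\<^sub>R (\<Sum>i\<le>d. ev (E j) i *\<^sub>R E i) + (\<Sum>i\<le>d. ev N i *\<^sub>R E i)"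
      by (simp add: j ev_linear scaleR_add_left sum.distrib scaleR_sum_right)
    also have "(\<Sum>i\<le>d. ev (E j) i *\<^sub>R E i) = (\<Sum>i\<le>d. if i = j then E j else 0)"
      using j by (intro sum.cong) (auto simp: ev_E)
    finally show ?case using step j by simp
  qed
qed

lemma BM_eqI:
  assumes "M \<in> BM" "N \<in> BM" "\<And>i. i \<le> d \<Longrightarrow> ev M i = ev N i" shows "M = N"
  using BM_expand[OF assms(1)] BM_expand[OF assms(2)] assms(3) by (metis (no_types, lifting) atMost_iff sum.cong)

lemma E_mult_BM:
  assumes "M \<in> BM" "k \<le> d" shows "E k ** M = ev M k *\<^sub>R E k" "M ** E k = ev M k *\<^sub>R E k"
proof -
  have "E k ** M = (\<Sum>i\<le>d. ev M i *\<^sub>R (E k ** E i))"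
    by (subst BM_expand[OF assms(1)]) (simp add: matmul.sum_right matmul.scaleR_right)
  also have "\<dots> = (\<Sum>i\<le>d. if i = k then ev M k *\<^sub>R E k else 0)"
    using assms by (intro sum.cong) (auto simp: E_mult)
  finally show "E k ** M = ev M k *\<^sub>R E k" using assms by simp
  then show "M ** E k = ev M k *\<^sub>R E k" using BM_commute E_in_BM assms by metis
qed

lemma ev_mult:
  assumes "M \<in> BM" "N \<in> BM" "k \<le> d" shows "ev (M ** N) k = ev M k * ev N k"
proof -
  have "ev (M ** N) k *\<^sub>R E k = E k ** (M ** N)" using E_mult_BM assms mult_in_BM by metis
  also have "\<dots> = (ev M k * ev N k) *\<^sub>R E k"
    by (simp add: matrix_mul_assoc E_mult_BM assms matmul.scaleR_left)
  finally show ?thesis using E_nonzero assms by simp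
qed

lemma ev_mat_1: "k \<le> d \<Longrightarrow> ev (mat 1) k = 1"
  using E_mult_BM(1)[OF mat_1_in_BM, of k] E_nonzero[of k]
  by (metis matrix_mul_rid scaleR_cancel_right scaleR_one)

lemma sum_E: "(\<Sum>i\<le>d. E i) = mat 1"
  using BM_expand[OF mat_1_in_BM] ev_mat_1 by simp

text \<open>A Krein parameter up to a positive factor (\<open>triple_krein\<close>). As a sum of
  entrywise products of three matrices it is symmetric in all indices, which the
  \<open>q h i j\<close> themselves are not.\<close>

definition triple :: "nat \<Rightarrow> nat \<Rightarrow> nat \<Rightarrow> real" where
  "triple h i j = E h \<bullet> schur_product (E i) (E j)"

lemma triple_sym: "triple h i j = triple h j i" "triple h i j = triple i h j"
  unfolding triple_def inner_schur_product by (simp_all add: mult_ac)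

lemma triple_krein:
  assumes "krein_parameters d E q" "h \<le> d" "i \<le> d" "j \<le> d"
  shows "triple h i j = q h i j * mult_of h / real CARD('x)"
proof -
  have "triple h i j = (1 / real CARD('x)) * (\<Sum>k\<le>d. q k i j * (E h \<bullet> E k))"
    using assms by (simp add: triple_def krein_parameters_def inner_sum_right)
  also have "(\<Sum>k\<le>d. q k i j * (E h \<bullet> E k)) = (\<Sum>k\<le>d. if k = h then q h i j * mult_of h else 0)"
    using assms by (intro sum.cong) (auto simp: mult_of_def E_inner)
  finally show ?thesis using assms by simp
qed

lemma Q_polynomial_triple:
  assumes "Q_polynomial_ordering d R E"
  shows "h \<le> d \<Longrightarrow> i + j < h \<Longrightarrow> triple h i j = 0"
    and "i + j \<le> d \<Longrightarrow> triple (i + j) i j > 0"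
proof -
  obtain q where q: "krein_parameters d E q"
    "\<forall>h\<le>d. \<forall>i\<le>d. \<forall>j\<le>d. int h < \<bar>int i - int j\<bar> \<or> h > i + j \<longrightarrow> q h i j = 0"
    "\<forall>i j. i + j \<le> d \<longrightarrow> q (i + j) i j > 0"
    using assms unfolding Q_polynomial_ordering_def by (elim conjE exE)
  show "triple h i j = 0" if "h \<le> d" "i + j < h"
    using q(2) that by (simp add: triple_krein[OF q(1)])
  show "triple (i + j) i j > 0" if "i + j \<le> d"
    using q(3) that mult_pos[of "i + j"] by (simp add: triple_krein[OF q(1)])
qed

text \<open>The diagonal gives \<open>E k\<close> trace 1, hence rank one. Its rows then agree up to
  sign and all entries are plus or minus \<open>1 / CARD('x)\<close>; the sign splits the points
  into two halves.\<close>

lemma rank_one_imprimitive: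
  assumes "k \<le> d" "k \<noteq> 0" and diag: "\<And>x. E k $ x $ x = 1 / real CARD('x)" and "CARD('x) > 2"
  shows "\<exists>w n \<F> \<I>. imprimitivity_system d R w n \<F> \<I> \<and>
    real n *\<^sub>R (E 0 + E k) = same_fibre_matrix \<F>"
proof -
  define v where "v = real CARD('x)"
  define f where "f x y = E k $ x $ y" for x y
  have v: "v > 2" using assms(4) by (simp add: v_def)
  have sym: "f x y = f y x" for x y
    using BM_symmetric[OF E_in_BM[OF assms(1)]] by (simp add: f_def)
  have prod: "(\<Sum>z\<in>UNIV. f x z * f y z) = f x y" for x y
  proof -
    have "(E k ** E k) $ x $ y = (\<Sum>z\<in>UNIV. f x z * f z y)"
      by (simp add: matrix_matrix_mult_def f_def)
    then show ?thesis using E_idem[OF assms(1)] by (simp add: sym[of _ y] f_def[symmetric])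
  qed
  have sq: "(\<Sum>z\<in>UNIV. (f x z)\<^sup>2) = 1 / v" for x
    using prod[of x x] diag[of x] by (simp add: power2_eq_square f_def v_def)
  \<comment> \<open>Rows are vectors whose Gram matrix is again \<open>f\<close>. Nonnegativity of
    \<open>minus\<close> and \<open>plus\<close> bounds the entries, and \<open>minus = 0\<close>
    forces two rows to coincide.\<close>
  have minus: "(\<Sum>z\<in>UNIV. (f x z - f y z)\<^sup>2) = 2 / v - 2 * f x y" for x y
    using sq[of x] sq[of y] prod[of x y]
    by (simp add: power2_diff sum.distrib sum_subtractf sum_distrib_left[symmetric] mult.assoc)
  have plus: "(\<Sum>z\<in>UNIV. (f x z + f y z)\<^sup>2) = 2 / v + 2 * f x y" for x y
    using sq[of x] sq[of y] prod[of x y]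
    by (simp add: power2_sum sum.distrib sum_distrib_left[symmetric] mult.assoc)
  have bound: "\<bar>f x y\<bar> \<le> 1 / v" for x y
  proof -
    have "0 \<le> 2 / v - 2 * f x y" "0 \<le> 2 / v + 2 * f x y"
      by (simp_all only: minus[symmetric] plus[symmetric] sum_nonneg zero_le_power2)
    then show ?thesis by (simp add: abs_le_iff)
  qed
  have abs: "\<bar>f x y\<bar> = 1 / v" for x y
  proof -
    \<comment> \<open>The \<open>v\<close> squares in a row add up to \<open>1 / v\<close> and each
      is at most \<open>1 / v\<close> squared, so each bound is attained.\<close>
    have le: "(f x z)\<^sup>2 \<le> (1 / v)\<^sup>2" for z
      using bound[of x z] v by (simp add: abs_le_square_iff[symmetric])
    have "(\<Sum>z\<in>UNIV. (1 / v)\<^sup>2 - (f x z)\<^sup>2) = 0"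
      using sq[of x] v by (simp add: sum_subtractf v_def[symmetric] power2_eq_square)
    then have "(1 / v)\<^sup>2 - (f x y)\<^sup>2 = 0"
      using le by (subst (asm) sum_nonneg_eq_0_iff) auto
    then have "\<bar>f x y\<bar> = \<bar>1 / v\<bar>" by (metis eq_iff_diff_eq_0 power2_eq_iff abs_minus)
    then show ?thesis using v by simp
  qed
  have two: "f x y = 1 / v \<or> f x y = - (1 / v)" for x y
    using abs[of x y] by linarith
  \<comment> \<open>Orthogonality to \<open>E 0\<close>: positive and negative entries balance, so
    every class \<open>S x\<close> has half of the points.\<close>
  have row: "(\<Sum>y\<in>UNIV. f x y) = 0" for x
  proof -
    have "(E k ** E 0) $ x $ x = (\<Sum>y\<in>UNIV. f x y * (1 / v))"
      by (simp add: matrix_matrix_mult_def f_def E_0_nth v_def)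
    then have "(\<Sum>y\<in>UNIV. f x y) / v = 0"
      using E_orthogonal[of k 0] assms by (simp add: sum_divide_distrib)
    then show ?thesis using v by simp
  qed
  define S where "S x = {y. f x y = 1 / v}" for x
  have same: "f x z = f y z" if "y \<in> S x" for x y z
  proof -
    have "(\<Sum>z\<in>UNIV. (f x z - f y z)\<^sup>2) = 0" using minus[of x y] that by (simp add: S_def)
    then show ?thesis by (subst (asm) sum_nonneg_eq_0_iff) auto
  qed
  have refl: "x \<in> S x" for x using diag by (simp add: S_def f_def v_def)
  have eq: "S y = S x" if "y \<in> S x" for x y using same[OF that] by (simp add: S_def)
  have size: "2 * real (card (S x)) = v" for x
  proof -
    have "(\<Sum>y\<in>UNIV. f x y) = (\<Sum>y\<in>UNIV. if y \<in> S x then 1 / v else - (1 / v))"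
      using two by (intro sum.cong) (auto simp: S_def)
    also have "\<dots> = real (card (S x)) / v - real (card (- S x)) / v"
      by (simp add: sum.If_cases)
    finally have "real (card (S x)) = real (card (- S x))" using row[of x] v by simp
    moreover have "card (S x) + card (- S x) = CARD('x)"
      by (metis Compl_disjoint Compl_partition card_Un_disjoint finite)
    ultimately show ?thesis by (simp add: v_def)
  qed
  define n where "n = CARD('x) div 2"
  have cardS: "card (S x) = n" for x using size[of x] by (simp add: n_def v_def)
  have v2: "CARD('x) = 2 * n"
    using size[of undefined] cardS[of undefined] by (simp add: v_def)
  define \<F> where "\<F> = range S"
  define \<I> where "\<I> = {i. i \<le> d \<and> (\<forall>x y. (x, y) \<in> R i \<longrightarrow> f x y = 1 / v)}"
  have part: "partition_on UNIV \<F>"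
    unfolding partition_on_def disjoint_def \<F>_def
    using refl eq by (auto, blast, blast+)
  have "CARD('x) = card (\<Union>\<F>)" using part by (simp add: partition_on_def)
  also have "\<dots> = (\<Sum>U\<in>\<F>. card U)"
    using part
    by (intro card_Union_disjoint) (auto simp: partition_on_def disjoint_def pairwise_def disjnt_def)
  also have "\<dots> = (\<Sum>U\<in>\<F>. n)" by (rule sum.cong) (auto simp: \<F>_def cardS)
  finally have "card \<F> = 2" using v2 assms(4) by simp
  have Fnth: "same_fibre_matrix \<F> $ x $ y = (if f x y = 1 / v then 1 else 0)" for x y
  proof -
    have "(\<exists>U\<in>\<F>. x \<in> U \<and> y \<in> U) \<longleftrightarrow> y \<in> S x"
      unfolding \<F>_def using refl eq by blast
    then show ?thesis by (simp add: same_fibre_matrix_def S_def)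
  qed
  have "(\<Sum>i\<in>\<I>. rel_matrix (R i)) = same_fibre_matrix \<F>"
    unfolding vec_eq_iff
  proof (intro allI)
    fix x y
    obtain h where h: "h \<le> d" "(x, y) \<in> R h" by (rule relation_exists)
    obtain c where c: "\<And>i x y. i \<le> d \<Longrightarrow> (x, y) \<in> R i \<Longrightarrow> f x y = c i"
      using E_in_BM[OF assms(1)] unfolding BM_iff f_def by metis
    have "h \<in> \<I> \<longleftrightarrow> f x y = 1 / v"
      using h c[of h] by (auto simp: \<I>_def)
    moreover have "\<I> \<subseteq> {..d}" by (auto simp: \<I>_def)
    ultimately show "(\<Sum>i\<in>\<I>. rel_matrix (R i)) $ x $ y = same_fibre_matrix \<F> $ x $ y"
      using sum_rel_matrix_nth[OF h(2,1), of \<I> "\<lambda>_. 1"] by (simp add: Fnth)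
  qed
  then have "imprimitivity_system d R 2 n \<F> \<I>"
    using part \<open>card \<F> = 2\<close> cardS v2 assms(4)
    by (auto simp: imprimitivity_system_def \<F>_def \<I>_def)
  moreover have "real n *\<^sub>R (E 0 + E k) = same_fibre_matrix \<F>"
    unfolding vec_eq_iff
  proof (intro allI)
    fix x y
    have "v = 2 * real n" using v2 by (simp add: v_def)
    then show "(real n *\<^sub>R (E 0 + E k)) $ x $ y = same_fibre_matrix \<F> $ x $ y"
      using two[of x y] v by (auto simp: Fnth E_0_nth v_def[symmetric] f_def[symmetric] field_simps)
  qed
  ultimately show ?thesis by blast
qed

end

section \<open>Fibres\<close>

definition fibre_proj :: "'x::finite set \<Rightarrow> real^'x^'x" where
  "fibre_proj U = (\<chi> x y. if x = y \<and> x \<in> U then 1 else 0)"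

lemma fibre_proj_mult_nth [simp]:
  "(fibre_proj U ** M) $ x $ y = (if x \<in> U then M $ x $ y else 0)"
  "(M ** fibre_proj U) $ x $ y = (if y \<in> U then M $ x $ y else 0)"
proof -
  have "(fibre_proj U ** M) $ x $ y = (\<Sum>z\<in>UNIV. if z = x then (if x \<in> U then M $ x $ y else 0) else 0)"
    unfolding matrix_matrix_mult_def fibre_proj_def vec_lambda_beta by (rule sum.cong) auto
  then show "(fibre_proj U ** M) $ x $ y = (if x \<in> U then M $ x $ y else 0)" by simp
  have "(M ** fibre_proj U) $ x $ y = (\<Sum>z\<in>UNIV. if z = y then (if y \<in> U then M $ x $ y else 0) else 0)"
    unfolding matrix_matrix_mult_def fibre_proj_def vec_lambda_beta by (rule sum.cong) auto
  then show "(M ** fibre_proj U) $ x $ y = (if y \<in> U then M $ x $ y else 0)" by simp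
qed

lemma transpose_fibre_proj: "transpose (fibre_proj U) = fibre_proj U"
  by (auto simp: fibre_proj_def transpose_def vec_eq_iff)

lemma block_eq: "block M U V = fibre_proj U ** M ** fibre_proj V"
  by (auto simp: block_def vec_eq_iff)

text \<open>Products of blocks have counts as entries, which is where the integrality in
  \<open>uniform_wrt\<close> comes from.\<close>

lemma block_mult_nth:
  "(block (rel_matrix S) U V ** block (rel_matrix T) V W) $ x $ y =
    (if x \<in> U \<and> y \<in> W then real (card {z \<in> V. (x, z) \<in> S \<and> (z, y) \<in> T}) else 0)"
proof -
  have "(block (rel_matrix S) U V ** block (rel_matrix T) V W) $ x $ y
      = (\<Sum>z\<in>UNIV. if x \<in> U \<and> y \<in> W \<and> z \<in> V \<and> (x, z) \<in> S \<and> (z, y) \<in> T then 1 else 0)"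
    unfolding matrix_matrix_mult_def block_def vec_lambda_beta by (rule sum.cong) auto
  also have "\<dots> = real (card {z. x \<in> U \<and> y \<in> W \<and> z \<in> V \<and> (x, z) \<in> S \<and> (z, y) \<in> T})"
    by (simp add: sum.If_cases)
  finally show ?thesis by auto
qed

lemma block_mult_eq:
  "block M U V ** block N V W = fibre_proj U ** M ** fibre_proj V ** N ** fibre_proj W"
proof -
  have "fibre_proj V ** fibre_proj V = fibre_proj V"
    by (simp add: vec_eq_iff) (simp add: fibre_proj_def)
  then show ?thesis by (simp add: block_eq) (metis matrix_mul_assoc)
qed

locale fibred_scheme = ordered_scheme +
  fixes w n :: nat and \<F> :: "'a set set" and \<I> :: "nat set"
  assumes system: "imprimitivity_system d R w n \<F> \<I>"
begin

lemma fibres: "partition_on UNIV \<F>" and card_fibres: "card \<F> = w"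
  and card_fibre: "U \<in> \<F> \<Longrightarrow> card U = n" and w_gt_1: "w > 1" and n_gt_1: "n > 1"
  and I_subset: "\<I> \<subseteq> {..d}"
  and sum_I: "(\<Sum>i\<in>\<I>. rel_matrix (R i)) = same_fibre_matrix \<F>"
  using system by (auto simp: imprimitivity_system_def)

lemma fibre_exists: obtains U where "U \<in> \<F>" "x \<in> U"
  using fibres unfolding partition_on_def by (metis UNIV_I UnionE)

lemma fibre_unique: "U \<in> \<F> \<Longrightarrow> V \<in> \<F> \<Longrightarrow> x \<in> U \<Longrightarrow> x \<in> V \<Longrightarrow> U = V"
  using fibres by (auto simp: partition_on_def disjoint_def)

lemma fibre_nonempty: "U \<in> \<F> \<Longrightarrow> \<exists>x. x \<in> U"
  using fibres unfolding partition_on_def by (metis all_not_in_conv)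

lemma finite_fibres: "finite \<F>"
  using w_gt_1 card_fibres card.infinite by fastforce

lemma other_fibre: obtains V where "V \<in> \<F>" "V \<noteq> U"
proof -
  have "\<not> \<F> \<subseteq> {U}"
    using card_mono[of "{U}" \<F>] card_fibres w_gt_1 by auto
  then show ?thesis using that by auto
qed

lemma card_points: "CARD('a) = w * n"
proof -
  have "CARD('a) = card (\<Union>\<F>)" using fibres by (simp add: partition_on_def)
  also have "\<dots> = (\<Sum>U\<in>\<F>. card U)"
    using fibres by (intro card_Union_disjoint) (auto simp: partition_on_def disjoint_def pairwise_def disjnt_def)
  finally show ?thesis by (simp add: card_fibre card_fibres)
qed

abbreviation "F \<equiv> same_fibre_matrix \<F>"

lemma F_nth:
  assumes "U \<in> \<F>" "V \<in> \<F>" "x \<in> U" "y \<in> V"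
  shows "F $ x $ y = (if U = V then 1 else 0)"
proof -
  have "(\<exists>W\<in>\<F>. x \<in> W \<and> y \<in> W) \<longleftrightarrow> U = V" using assms fibre_unique by metis
  then show ?thesis by (simp add: same_fibre_matrix_def)
qed

lemma F_in_BM: "F \<in> BM"
  unfolding sum_I[symmetric] using I_subset by (auto intro!: rel_matrix_in_BM)

lemma F_relation:
  assumes "(x, y) \<in> R h" "h \<le> d" shows "F $ x $ y = (if h \<in> \<I> then 1 else 0)"
  using sum_rel_matrix_nth[OF assms I_subset, of "\<lambda>_. 1"] by (simp add: sum_I)

lemma relation_in_I:
  assumes "(x, y) \<in> R h" "h \<le> d" "U \<in> \<F>" "V \<in> \<F>" "x \<in> U" "y \<in> V"
  shows "h \<in> \<I> \<longleftrightarrow> U = V"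
  using F_relation[OF assms(1,2)] F_nth[OF assms(3-6)] by (auto split: if_splits)

lemma F_mult_nth:
  assumes "U \<in> \<F>" "x \<in> U" shows "(F ** M) $ x $ y = (\<Sum>z\<in>U. M $ z $ y)"
proof -
  have "F $ x $ z = (if z \<in> U then 1 else 0)" for z
    using F_nth[OF assms(1) _ assms(2)] by (metis fibre_exists fibre_unique assms(1))
  then show ?thesis
    by (simp add: matrix_matrix_mult_def if_distrib[of "\<lambda>c. c * _"] sum.If_cases cong: if_cong)
qed

lemma F_square: "F ** F = real n *\<^sub>R F"
  unfolding vec_eq_iff
proof (intro allI)
  fix x y
  obtain U V where U: "U \<in> \<F>" "x \<in> U" and V: "V \<in> \<F>" "y \<in> V" by (metis fibre_exists)
  have "(F ** F) $ x $ y = (\<Sum>z\<in>U. if U = V then 1 else 0)"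
    unfolding F_mult_nth[OF U] using F_nth U V by (intro sum.cong) auto
  then show "(F ** F) $ x $ y = (real n *\<^sub>R F) $ x $ y"
    using F_nth[OF U(1) V(1) U(2) V(2)] U by (simp add: card_fibre)
qed

subsection \<open>Block diagonal parts\<close>

abbreviation "D \<equiv> fibre_proj"

text \<open>The sum of the diagonal blocks of \<open>M\<close> (\<open>bd_sum_D\<close>). Written as
  an entrywise product with \<open>F\<close>, it visibly maps \<open>BM\<close> into itself.\<close>

definition bd :: "real^'a^'a \<Rightarrow> real^'a^'a" where "bd M = schur_product M F"

lemma D_idem: "D U ** D U = D U"
  by (simp add: vec_eq_iff) (simp add: fibre_proj_def)

lemma D_mult_D: "M ** D U ** (D U ** N) = M ** D U ** N" for M N :: "real^'a^'a"
proof -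
  have "M ** D U ** (D U ** N) = M ** (D U ** D U) ** N" by (simp only: matrix_mul_assoc)
  then show ?thesis by (simp only: D_idem)
qed

lemma D_orthogonal: "U \<in> \<F> \<Longrightarrow> V \<in> \<F> \<Longrightarrow> U \<noteq> V \<Longrightarrow> D U ** D V = 0"
  using fibre_unique by (simp add: vec_eq_iff) (auto simp: fibre_proj_def)

lemma sum_D: "(\<Sum>U\<in>\<F>. D U) = mat 1"
  unfolding vec_eq_iff
proof (intro allI)
  fix x y
  obtain V where V: "V \<in> \<F>" "x \<in> V" by (rule fibre_exists)
  have "(\<Sum>U\<in>\<F>. D U) $ x $ y = (\<Sum>U\<in>\<F>. if U = V then (if x = y then 1 else 0) else 0)"
    unfolding sum_component using V fibre_unique by (intro sum.cong) (auto simp: fibre_proj_def)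
  then show "(\<Sum>U\<in>\<F>. D U) $ x $ y = mat 1 $ x $ y"
    using finite_fibres V by (simp add: mat_def)
qed

lemma D_eqI:
  fixes M N :: "real^'a^'a"
  assumes "\<And>U. U \<in> \<F> \<Longrightarrow> D U ** M = D U ** N" shows "M = N"
proof -
  have "(\<Sum>U\<in>\<F>. D U) ** M = (\<Sum>U\<in>\<F>. D U) ** N"
    unfolding matmul.sum_left by (rule sum.cong) (auto simp: assms)
  then show ?thesis by (simp add: sum_D)
qed

lemma D_bd: "U \<in> \<F> \<Longrightarrow> D U ** bd M = D U ** M ** D U"
  and bd_D: "U \<in> \<F> \<Longrightarrow> bd M ** D U = D U ** M ** D U"
proof -
  have *: "bd M $ x $ y = (if y \<in> U then M $ x $ y else 0)"
    "bd M $ y $ x = (if y \<in> U then M $ y $ x else 0)" if "U \<in> \<F>" "x \<in> U" for x y U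
  proof -
    obtain V where V: "V \<in> \<F>" "y \<in> V" by (rule fibre_exists)
    then have "y \<in> U \<longleftrightarrow> U = V" using that fibre_unique by blast
    then show "bd M $ x $ y = (if y \<in> U then M $ x $ y else 0)"
      "bd M $ y $ x = (if y \<in> U then M $ y $ x else 0)"
      using F_nth[of U V x y] F_nth[of V U y x] that V by (auto simp: bd_def)
  qed
  show "U \<in> \<F> \<Longrightarrow> D U ** bd M = D U ** M ** D U"
    and "U \<in> \<F> \<Longrightarrow> bd M ** D U = D U ** M ** D U"
    using * by (auto simp: vec_eq_iff)
qed

lemma bd_sum_D: "bd M = (\<Sum>U\<in>\<F>. D U ** M ** D U)"
proof -
  have "bd M = (\<Sum>U\<in>\<F>. D U) ** bd M" by (simp add: sum_D)
  also have "\<dots> = (\<Sum>U\<in>\<F>. D U ** bd M)" by (simp add: matmul.sum_left)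
  finally show ?thesis by (simp add: D_bd)
qed

lemma bd_linear:
  "bd (M + N) = bd M + bd N" "bd (M - N) = bd M - bd N" "bd (c *\<^sub>R M) = c *\<^sub>R bd M"
  by (simp_all add: bd_def vec_eq_iff algebra_simps)

lemma bd_sum: "bd (sum f S) = (\<Sum>i\<in>S. bd (f i))"
  by (simp add: bd_def vec_eq_iff sum_distrib_right)

lemma bd_bd: "bd (bd M) = bd M"
  by (simp add: bd_def same_fibre_matrix_def vec_eq_iff)

lemma bd_in_BM: "M \<in> BM \<Longrightarrow> bd M \<in> BM"
  by (simp add: bd_def schur_in_BM F_in_BM)

lemma bd_commute_D: "bd K = K \<Longrightarrow> U \<in> \<F> \<Longrightarrow> D U ** K = K ** D U"
  by (metis D_bd bd_D)

text \<open>A block diagonal \<open>K\<close> commutes with every \<open>D U\<close>, so it can be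
  pulled out of each diagonal block.\<close>

lemma bd_mult:
  assumes "bd K = K" shows "bd (K ** M) = K ** bd M"
proof (rule D_eqI)
  fix U assume U: "U \<in> \<F>"
  have "D U ** bd (K ** M) = (D U ** K) ** M ** D U"
    using U by (simp add: D_bd matrix_mul_assoc)
  also have "\<dots> = K ** (D U ** M ** D U)"
    using U assms by (simp add: bd_commute_D matrix_mul_assoc)
  also have "\<dots> = (K ** D U) ** bd M"
    using U by (simp only: D_bd[symmetric] matrix_mul_assoc)
  also have "\<dots> = D U ** (K ** bd M)"
    using U assms by (simp add: bd_commute_D[symmetric] matrix_mul_assoc)
  finally show "D U ** bd (K ** M) = D U ** (K ** bd M)" .
qed

lemma off_diagonal_eqI:
  fixes M N :: "real^'a^'a"
  assumes "bd M = bd N"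
    and "\<And>U V. U \<in> \<F> \<Longrightarrow> V \<in> \<F> \<Longrightarrow> U \<noteq> V \<Longrightarrow> D U ** M ** D V = D U ** N ** D V"
  shows "M = N"
proof (rule D_eqI)
  fix U assume U: "U \<in> \<F>"
  have eq: "D U ** M ** D V = D U ** N ** D V" if "V \<in> \<F>" for V
    using assms U that D_bd by (metis (full_types))
  have "D U ** M = D U ** M ** (\<Sum>V\<in>\<F>. D V)" by (simp add: sum_D)
  also have "\<dots> = (\<Sum>V\<in>\<F>. D U ** N ** D V)"
    by (simp add: matmul.sum_right eq)
  also have "\<dots> = D U ** N ** (\<Sum>V\<in>\<F>. D V)" by (simp add: matmul.sum_right)
  finally show "D U ** M = D U ** N" by (simp add: sum_D)
qed

section \<open>Similarity of idempotents and the block diagonal subalgebra\<close>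

lemma norm_E_D_E:
  assumes "h \<le> d" "i \<le> d"
  shows "(norm (E h ** D U ** E i))\<^sup>2 = E h \<bullet> (D U ** E i ** D U)"
proof -
  have "(norm (E h ** D U ** E i))\<^sup>2 = (E h ** (D U ** E i)) \<bullet> (E h ** D U ** E i)"
    by (simp add: power2_norm_eq_inner matrix_mul_assoc)
  also have "\<dots> = (D U ** E i) \<bullet> ((E h ** E h) ** D U ** E i)"
    using assms inner_matmul_left[of "E h" "D U ** E i"] by (simp add: transpose_E matrix_mul_assoc)
  also have "\<dots> = (E h ** D U ** E i) \<bullet> (D U ** E i)"
    using assms by (simp add: E_idem inner_commute)
  also have "\<dots> = (E h ** D U) \<bullet> (D U ** (E i ** E i))"
    using assms by (simp add: inner_matmul_right[of _ "E i"] transpose_E matrix_mul_assoc)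
  also have "\<dots> = E h \<bullet> (D U ** E i ** D U)"
    using assms by (simp add: E_idem inner_matmul_right transpose_fibre_proj)
  finally show ?thesis .
qed

lemma E_inner_bd:
  assumes "h \<le> d" "i \<le> d"
  shows "E h \<bullet> bd (E i) = (\<Sum>U\<in>\<F>. (norm (E h ** D U ** E i))\<^sup>2)"
  using assms by (simp add: norm_E_D_E bd_sum_D inner_sum_right)

definition sim :: "nat \<Rightarrow> nat \<Rightarrow> bool" where
  "sim h i \<longleftrightarrow> (\<exists>U\<in>\<F>. E h ** D U ** E i \<noteq> 0)"

text \<open>The inner product is a sum of squared norms over the fibres, so it vanishes only if
  every term does. Thus similarity can be tested inside \<open>BM\<close>, without mention of a
  fibre.\<close>

lemma sim_iff:
  assumes "h \<le> d" "i \<le> d" shows "sim h i \<longleftrightarrow> E h \<bullet> bd (E i) \<noteq> 0"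
  unfolding E_inner_bd[OF assms] sim_def
  using finite_fibres by (subst sum_nonneg_eq_0_iff) auto

lemma sim_iff_ev:
  assumes "h \<le> d" "i \<le> d" shows "sim h i \<longleftrightarrow> ev (bd (E i)) h \<noteq> 0"
  using sim_iff[OF assms] mult_pos[OF assms(1)] by (auto simp: ev_def)

lemma sim_sym:
  assumes "h \<le> d" "i \<le> d" "sim h i" shows "sim i h"
proof -
  obtain U where U: "U \<in> \<F>" "E h ** D U ** E i \<noteq> 0" using assms by (auto simp: sim_def)
  have "transpose (E i ** D U ** E h) = E h ** D U ** E i"
    using assms by (simp add: matrix_transpose_mul transpose_E transpose_fibre_proj matrix_mul_assoc)
  then have "E i ** D U ** E h \<noteq> 0"
    using U by (auto simp: transpose_def vec_eq_iff)
  then show ?thesis using U by (auto simp: sim_def)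
qed

lemma sim_refl:
  assumes "i \<le> d" shows "sim i i"
proof (rule ccontr)
  assume "\<not> sim i i"
  then have "(\<Sum>U\<in>\<F>. E i ** D U ** E i) = 0" by (simp add: sim_def)
  then have "E i ** (\<Sum>U\<in>\<F>. D U) ** E i = 0"
    by (simp add: matmul.sum_left matmul.sum_right)
  then show False using assms by (simp add: sum_D E_idem E_nonzero)
qed

text \<open>A block diagonal matrix commutes with every \<open>D U\<close>.\<close>

lemma ev_sim:
  assumes "h \<le> d" "i \<le> d" "sim h i" "K \<in> BM" "bd K = K" shows "ev K h = ev K i"
proof -
  obtain U where U: "U \<in> \<F>" "E h ** D U ** E i \<noteq> 0" using assms by (auto simp: sim_def)
  have "ev K h *\<^sub>R (E h ** D U ** E i) = (E h ** K) ** D U ** E i"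
    using assms by (simp add: E_mult_BM matmul.scaleR_left)
  also have "\<dots> = E h ** (K ** D U) ** E i" by (simp add: matrix_mul_assoc)
  also have "\<dots> = E h ** D U ** (K ** E i)"
    using U assms by (simp add: bd_commute_D[symmetric] matrix_mul_assoc)
  also have "\<dots> = ev K i *\<^sub>R (E h ** D U ** E i)"
    using assms by (simp add: E_mult_BM matmul.scaleR_right)
  finally show ?thesis using U by simp
qed

text \<open>\<open>al i\<close> is the factor in \<open>bd (E i) = al i *\<^sub>R eps i\<close>, where \<open>eps i\<close> is the primitive idempotent
  of the block diagonal subalgebra that lies over \<open>E i\<close>.\<close>

definition al :: "nat \<Rightarrow> real" where "al i = ev (bd (E i)) i"

lemma al_pos: "i \<le> d \<Longrightarrow> al i > 0"
  using sim_iff_ev[of i i] sim_refl[of i] mult_pos[of i]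
  by (auto simp: al_def ev_def E_inner_bd less_le intro!: sum_nonneg divide_nonneg_pos)

text \<open>\<open>bd (E i)\<close> is itself block diagonal, so its eigenvalue is constant on the
  class of \<open>i\<close> by \<open>ev_sim\<close>; outside that class it is zero by
  \<open>sim_iff_ev\<close>.\<close>

lemma ev_bd_E:
  assumes "h \<le> d" "i \<le> d" shows "ev (bd (E i)) h = (if sim h i then al i else 0)"
  using assms sim_iff_ev[OF assms] ev_sim[OF assms, of "bd (E i)"]
  by (auto simp: al_def bd_bd bd_in_BM E_in_BM)

text \<open>Similarity to \<open>k\<close> means that \<open>bd (E k)\<close> has a nonzero
  eigenvalue, and that eigenvalue is the same at \<open>h\<close> and at \<open>i\<close>.\<close>

lemma sim_trans:
  assumes "h \<le> d" "i \<le> d" "k \<le> d" "sim h i" "sim i k" shows "sim h k"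
proof -
  have "ev (bd (E k)) h = ev (bd (E k)) i"
    using assms by (intro ev_sim) (auto simp: bd_bd bd_in_BM E_in_BM)
  then show ?thesis using assms by (simp add: sim_iff_ev)
qed

definition eps :: "nat \<Rightarrow> real^'a^'a" where "eps i = (\<Sum>h\<in>{h. h \<le> d \<and> sim h i}. E h)"

lemma eps_in_BM: "eps i \<in> BM"
  unfolding eps_def by (auto intro: E_in_BM)

lemma ev_eps: "h \<le> d \<Longrightarrow> ev (eps i) h = (if sim h i then 1 else 0)"
  by (simp add: eps_def ev_sum ev_E)

lemma bd_E: "i \<le> d \<Longrightarrow> bd (E i) = al i *\<^sub>R eps i"
  by (rule BM_eqI) (auto simp: bd_in_BM E_in_BM eps_in_BM ev_linear ev_eps ev_bd_E)

lemma bd_eps: assumes "i \<le> d" shows "bd (eps i) = eps i"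
proof -
  have "al i *\<^sub>R bd (eps i) = al i *\<^sub>R eps i"
    using bd_bd[of "E i"] by (simp add: bd_E[OF assms] bd_linear)
  then show ?thesis using al_pos[OF assms] by simp
qed

lemma eps_E: "h \<le> d \<Longrightarrow> sim h i \<Longrightarrow> eps i ** E h = E h" "h \<le> d \<Longrightarrow> sim h i \<Longrightarrow> E h ** eps i = E h"
  by (simp_all add: E_mult_BM eps_in_BM ev_eps)

lemma eps_sim:
  assumes "h \<le> d" "i \<le> d" "sim h i" shows "eps h = eps i"
proof (rule BM_eqI)
  fix k assume "k \<le> d"
  then show "ev (eps h) k = ev (eps i) k"
    using assms sim_trans[of k h i] sim_trans[of k i h] sim_sym[of h i] by (auto simp: ev_eps)
qed (simp_all add: eps_in_BM)

text \<open>Apply \<open>bd\<close> to the definition of \<open>eps i\<close>: the left side is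
  fixed and each \<open>E h\<close> in the class contributes
  \<open>al h *\<^sub>R eps i\<close>.\<close>

lemma sum_al: assumes "i \<le> d" shows "(\<Sum>h\<in>{h. h \<le> d \<and> sim h i}. al h) = 1"
proof -
  have "eps i = (\<Sum>h\<in>{h. h \<le> d \<and> sim h i}. bd (E h))"
    using bd_eps[OF assms] by (simp add: eps_def bd_sum)
  also have "\<dots> = (\<Sum>h\<in>{h. h \<le> d \<and> sim h i}. al h *\<^sub>R eps i)"
  proof (rule sum.cong[OF refl])
    fix h assume "h \<in> {h. h \<le> d \<and> sim h i}"
    then show "bd (E h) = al h *\<^sub>R eps i" using assms bd_E[of h] eps_sim[of h i] by simp
  qed
  finally have "eps i = (\<Sum>h\<in>{h. h \<le> d \<and> sim h i}. al h) *\<^sub>R eps i"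
    by (simp only: scaleR_left.sum)
  then have "ev (eps i) i = (\<Sum>h\<in>{h. h \<le> d \<and> sim h i}. al h) * ev (eps i) i"
    using ev_linear(3) by metis
  then show ?thesis using assms by (simp add: ev_eps sim_refl)
qed

text \<open>\<open>E j\<close> is a combination of \<open>F\<close> and the all-ones matrix.
  Entrywise multiplication by the former is \<open>bd\<close>, by the latter the identity.\<close>

lemma triple_fibre:
  assumes "real n *\<^sub>R (E 0 + E j) = F" "h \<le> d" "i \<le> d"
  shows "triple h i j = (E h \<bullet> bd (E i)) / real n - (E h \<bullet> E i) / real (w * n)"
proof -
  have "E j $ x $ y = F $ x $ y / real n - 1 / real (w * n)" for x y
    using n_gt_1 E_0_nth[of x y]
    by (simp add: assms(1)[symmetric] card_points field_simps)
  then have "schur_product (E i) (E j) = (1 / real n) *\<^sub>R bd (E i) - (1 / real (w * n)) *\<^sub>R E i"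
    by (simp add: vec_eq_iff bd_def right_diff_distrib)
  then show ?thesis by (simp add: triple_def inner_diff_right)
qed

lemma triple_sim:
  assumes "real n *\<^sub>R (E 0 + E j) = F" "h \<le> d" "i \<le> d" "h \<noteq> i"
  shows "triple h i j \<noteq> 0 \<longleftrightarrow> sim h i"
  using triple_fibre[OF assms(1-3)] n_gt_1 assms by (simp add: E_inner sim_iff)

text \<open>The diagonal Krein parameter measures how far \<open>al i\<close> is from
  \<open>1 / w\<close>.\<close>

lemma triple_al:
  assumes "real n *\<^sub>R (E 0 + E j) = F" "i \<le> d"
  shows "triple i i j = mult_of i * (al i - 1 / real w) / real n"
proof -
  have "E i \<bullet> bd (E i) = mult_of i * al i"
    using mult_pos[OF assms(2)] by (simp add: al_def ev_def)
  then show ?thesis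
    using triple_fibre[OF assms(1,2,2)] n_gt_1 w_gt_1
    by (simp add: mult_of_def[symmetric] field_simps)
qed

section \<open>Q-antipodal schemes are uniform\<close>

text \<open>Reduces uniformity to products of two off-diagonal blocks, with a matrix
  \<open>K\<close> in \<open>BM\<close> in place of integer coefficients. The condition on
  \<open>fibre_indices\<close> follows from \<open>K\<close> having constant diagonal, integrality
  from the entries being counts.\<close>

lemma uniform_wrtI:
  assumes prod: "\<And>i j. i \<in> {..d} - \<I> \<Longrightarrow> j \<in> {..d} - \<I> \<Longrightarrow> \<exists>K\<in>BM. \<forall>U\<in>\<F>. \<forall>V\<in>\<F>. \<forall>W\<in>\<F>.
    U \<noteq> V \<longrightarrow> V \<noteq> W \<longrightarrow> block (rel_matrix (R i)) U V ** block (rel_matrix (R j)) V W = block K U W"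
  shows "uniform_wrt d R \<F> \<I>"
proof -
  have fi: "i \<in> \<I> \<longleftrightarrow> U = V" "i \<le> d" if "i \<in> fibre_indices d R U V" "U \<in> \<F>" "V \<in> \<F>" for i U V
    using that relation_in_I[of _ _ i U V] by (auto simp: fibre_indices_def)
  have all: "fibre_indices d R U V = {..d} - \<I>" if UV: "U \<in> \<F>" "V \<in> \<F>" "U \<noteq> V" for U V
  proof (intro equalityI subsetI)
    fix i assume "i \<in> fibre_indices d R U V"
    then show "i \<in> {..d} - \<I>" using fi UV by auto
  next
    fix i assume i: "i \<in> {..d} - \<I>"
    obtain K where K: "K \<in> BM" "\<forall>U\<in>\<F>. \<forall>V\<in>\<F>. \<forall>W\<in>\<F>. U \<noteq> V \<longrightarrow> V \<noteq> W \<longrightarrow>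
        block (rel_matrix (R i)) U V ** block (rel_matrix (R i)) V W = block K U W"
      using prod[OF i i] by (rule bexE)
    have diag: "K $ x $ x = real (card {z \<in> V. (x, z) \<in> R i \<and> (z, x) \<in> R i})"
      if "U \<in> \<F>" "V \<in> \<F>" "U \<noteq> V" "x \<in> U" for U V x
      using K(2)[rule_format, of U V U] block_mult_nth[of "R i" U V "R i" U x x] that by (simp add: block_def)
    have "R i \<noteq> {}" using scheme i unfolding assoc_scheme_def by (metis DiffD1 atMost_iff)
    then obtain x0 y0 where xy: "(x0, y0) \<in> R i" by auto
    obtain U0 V0 where U0: "U0 \<in> \<F>" "x0 \<in> U0" and V0: "V0 \<in> \<F>" "y0 \<in> V0"
      by (metis fibre_exists)
    have "U0 \<noteq> V0" using relation_in_I[OF xy _ U0(1) V0(1) U0(2) V0(2)] i by auto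
    moreover have "y0 \<in> {z \<in> V0. (x0, z) \<in> R i \<and> (z, x0) \<in> R i}"
      using xy V0 relation_sym i by auto
    then have "card {z \<in> V0. (x0, z) \<in> R i \<and> (z, x0) \<in> R i} > 0"
      by (metis card_gt_0_iff empty_iff finite)
    ultimately have pos: "K $ x0 $ x0 > 0" using diag[OF U0(1) V0(1) _ U0(2)] by simp
    obtain x where x: "x \<in> U" using UV fibre_nonempty by blast
    \<comment> \<open>The count is positive for one point and one other fibre; the constant diagonal
      of \<open>K\<close> carries this to every point of \<open>U\<close> and every fibre
      \<open>V\<close> distinct from \<open>U\<close>.\<close>
    have "K $ x $ x > 0" using pos BM_diag[OF K(1)] by metis
    then have "{z \<in> V. (x, z) \<in> R i \<and> (z, x) \<in> R i} \<noteq> {}"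
      using diag[OF UV x] by (metis card.empty less_irrefl of_nat_0)
    then show "i \<in> fibre_indices d R U V" using i x by (auto simp: fibre_indices_def)
  qed
  have ex: "\<exists>K\<in>BM. \<forall>U\<in>\<F>. \<forall>V\<in>\<F>. \<forall>W\<in>\<F>. i \<in> fibre_indices d R U V \<longrightarrow> j \<in> fibre_indices d R V W \<longrightarrow>
     block (rel_matrix (R i)) U V ** block (rel_matrix (R j)) V W = block K U W"
    if "i \<le> d" "j \<le> d" for i j
  proof (cases "i \<in> \<I> \<or> j \<in> \<I>")
    case True
    have bdI: "bd (rel_matrix (R k)) = rel_matrix (R k)" if "k \<in> \<I>" for k
    proof -
      have "k \<le> d" using that I_subset by auto
      then show ?thesis using F_relation[of _ _ k] that by (auto simp: bd_def vec_eq_iff)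
    qed
    have "block (rel_matrix (R i)) U V ** block (rel_matrix (R j)) V W
        = block (rel_matrix (R i) ** rel_matrix (R j)) U W"
      if UVW: "U \<in> \<F>" "V \<in> \<F>" "W \<in> \<F>" "i \<in> fibre_indices d R U V" "j \<in> fibre_indices d R V W" for U V W
      using True
    proof
      assume "i \<in> \<I>"
      then have UV: "U = V" using fi UVW by blast
      have "D U ** rel_matrix (R i) ** D U = D U ** rel_matrix (R i)"
        using bd_commute_D[OF bdI[OF \<open>i \<in> \<I>\<close>] UVW(1)] D_idem by (metis matrix_mul_assoc)
      then show ?thesis unfolding block_mult_eq UV by (simp add: block_eq matrix_mul_assoc)
    next
      assume "j \<in> \<I>"
      then have VW: "V = W" using fi UVW by blast
      have "D W ** rel_matrix (R j) ** D W = rel_matrix (R j) ** D W"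
        using bd_commute_D[OF bdI[OF \<open>j \<in> \<I>\<close>] UVW(3)] D_idem by (metis matrix_mul_assoc)
      then have "D U ** rel_matrix (R i) ** (D W ** rel_matrix (R j) ** D W)
          = D U ** rel_matrix (R i) ** (rel_matrix (R j) ** D W)" by simp
      then show ?thesis unfolding block_mult_eq VW by (simp add: block_eq matrix_mul_assoc)
    qed
    then show ?thesis
      by (intro bexI[of _ "rel_matrix (R i) ** rel_matrix (R j)"] mult_in_BM rel_matrix_in_BM that) simp
  next
    case False
    then have "i \<in> {..d} - \<I>" "j \<in> {..d} - \<I>" using that by auto
    from prod[OF this] obtain K where K: "K \<in> BM" "\<forall>U\<in>\<F>. \<forall>V\<in>\<F>. \<forall>W\<in>\<F>. U \<noteq> V \<longrightarrow> V \<noteq> W \<longrightarrow>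
        block (rel_matrix (R i)) U V ** block (rel_matrix (R j)) V W = block K U W"
      by (rule bexE)
    show ?thesis
      by (rule bexI[OF _ K(1)], intro ballI impI, rule K(2)[rule_format]) (use fi False in blast)+
  qed
  \<comment> \<open>The witness is chosen per pair \<open>(i, j)\<close>, before the fibres, because
    the coefficients must not depend on \<open>U\<close>, \<open>V\<close>,
    \<open>W\<close>.\<close>
  define G where "G i j = (SOME K. K \<in> BM \<and> (\<forall>U\<in>\<F>. \<forall>V\<in>\<F>. \<forall>W\<in>\<F>.
     i \<in> fibre_indices d R U V \<longrightarrow> j \<in> fibre_indices d R V W \<longrightarrow>
     block (rel_matrix (R i)) U V ** block (rel_matrix (R j)) V W = block K U W))" for i j
  have G: "G i j \<in> BM \<and> (\<forall>U\<in>\<F>. \<forall>V\<in>\<F>. \<forall>W\<in>\<F>.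
     i \<in> fibre_indices d R U V \<longrightarrow> j \<in> fibre_indices d R V W \<longrightarrow>
     block (rel_matrix (R i)) U V ** block (rel_matrix (R j)) V W = block (G i j) U W)"
    if "i \<le> d" "j \<le> d" for i j
    unfolding G_def using ex[OF that] unfolding Bex_def by (rule someI_ex)
  define c where "c i j = (SOME c. \<forall>h\<le>d. \<forall>x y. (x, y) \<in> R h \<longrightarrow> G i j $ x $ y = c h)" for i j
  have c: "\<forall>h\<le>d. \<forall>x y. (x, y) \<in> R h \<longrightarrow> G i j $ x $ y = c i j h" if "i \<le> d" "j \<le> d" for i j
    unfolding c_def using conjunct1[OF G[OF that]] unfolding BM_iff by (rule someI_ex)
  \<comment> \<open>Where \<open>R h\<close> meets \<open>U \<times> W\<close> the value
    \<open>c i j h\<close> is a cardinality, so the floor changes nothing; elsewhere the block of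
    \<open>R h\<close> is zero and the floor only supplies some integer.\<close>
  have "block (rel_matrix (R i)) U V ** block (rel_matrix (R j)) V W =
      (\<Sum>h\<le>d. real_of_int \<lfloor>c i j h\<rfloor> *\<^sub>R block (rel_matrix (R h)) U W)"
    if UVW: "U \<in> \<F>" "V \<in> \<F>" "W \<in> \<F>" "i \<in> fibre_indices d R U V" "j \<in> fibre_indices d R V W"
    for i j U V W
    unfolding vec_eq_iff
  proof (intro allI)
    fix x y
    have ij: "i \<le> d" "j \<le> d" using UVW fi by blast+
    obtain h where h: "h \<le> d" "(x, y) \<in> R h" by (rule relation_exists)
    have P: "block (rel_matrix (R i)) U V ** block (rel_matrix (R j)) V W = block (G i j) U W"
      using G[OF ij] UVW by simp
    have "(\<Sum>h\<le>d. real_of_int \<lfloor>c i j h\<rfloor> *\<^sub>R block (rel_matrix (R h)) U W) $ x $ y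
        = (if x \<in> U \<and> y \<in> W then (\<Sum>h\<le>d. real_of_int \<lfloor>c i j h\<rfloor> *\<^sub>R rel_matrix (R h)) $ x $ y else 0)"
      by (cases "x \<in> U \<and> y \<in> W") (auto simp: block_def)
    also have "\<dots> = (if x \<in> U \<and> y \<in> W then real_of_int \<lfloor>c i j h\<rfloor> else 0)"
      using h by (subst sum_rel_matrix_nth[OF h(2,1)]) auto
    also have "\<dots> = (block (rel_matrix (R i)) U V ** block (rel_matrix (R j)) V W) $ x $ y"
    proof (cases "x \<in> U \<and> y \<in> W")
      case True
      then have "c i j h = block (G i j) U W $ x $ y" using c[OF ij] h by (simp add: block_def)
      also have "\<dots> = real (card {z \<in> V. (x, z) \<in> R i \<and> (z, y) \<in> R j})"
        unfolding P[symmetric] block_mult_nth using True by simp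
      finally show ?thesis unfolding block_mult_nth using True by simp
    qed (auto simp: block_mult_nth)
    finally show "(block (rel_matrix (R i)) U V ** block (rel_matrix (R j)) V W) $ x $ y
      = (\<Sum>h\<le>d. real_of_int \<lfloor>c i j h\<rfloor> *\<^sub>R block (rel_matrix (R h)) U W) $ x $ y" by simp
  qed
  then show ?thesis
    unfolding uniform_wrt_def
    by (intro conjI exI[of _ "\<lambda>h i j. \<lfloor>c i j h\<rfloor>"]) (simp_all add: all)
qed

text \<open>\<open>E i\<close> has constant diagonal, so each of the \<open>w\<close> fibres of
  equal size carries the same share of its trace.\<close>

lemma D_inner_E:
  assumes "i \<le> d" "U \<in> \<F>" shows "D U \<bullet> E i = mult_of i / real w"
proof -
  obtain e where e: "\<And>y. E i $ y $ y = e" using BM_diag[OF E_in_BM[OF assms(1)]] by metis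
  have "mult_of i = mat 1 \<bullet> E i"
    using inner_matmul_right[of "mat 1" "E i" "E i"] assms
    by (simp add: mult_of_def transpose_E E_idem)
  also have "\<dots> = real (w * n) * e"
    unfolding inner_mat_1 e by (simp add: card_points)
  finally have m: "mult_of i = real (w * n) * e" .
  have "D U \<bullet> E i = (\<Sum>y\<in>UNIV. \<Sum>z\<in>UNIV. if z = y then (if y \<in> U then e else 0) else 0)"
    unfolding inner_matrix_entries fibre_proj_def vec_lambda_beta by (intro sum.cong) (auto simp: e)
  also have "\<dots> = real n * e"
    using card_fibre[OF assms(2)] by (simp add: sum.If_cases)
  finally show ?thesis using m w_gt_1 by simp
qed

text \<open>Evaluate the norm of the difference; equality holds because \<open>w (E\<^sub>i)\<^sup>V\<^sup>V\<close> is a projection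
  of the same rank as \<open>E\<^sub>i\<close>.\<close>

lemma E_D_E:
  assumes "i \<le> d" "U \<in> \<F>" "al i = 1 / real w"
  shows "E i ** D U ** E i = (1 / real w) *\<^sub>R E i"
proof -
  let ?X = "E i ** D U ** E i" and ?m = "mult_of i"
  have "?X \<bullet> ?X = E i \<bullet> (D U ** bd (E i))"
    using norm_E_D_E[OF assms(1,1)] assms by (simp add: power2_norm_eq_inner D_bd)
  also have "\<dots> = (1 / real w) * ((D U ** eps i) \<bullet> E i)"
    using assms by (simp add: bd_E matmul.scaleR_right inner_commute)
  also have "(D U ** eps i) \<bullet> E i = D U \<bullet> E i"
    using assms by (simp add: inner_matmul_right transpose_BM eps_in_BM eps_E sim_refl)
  finally have XX: "?X \<bullet> ?X = ?m / (real w)\<^sup>2"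
    using D_inner_E[OF assms(1,2)] by (simp add: power2_eq_square)
  have "?X \<bullet> E i = (E i ** D U) \<bullet> E i"
    using assms by (simp add: inner_matmul_right[of _ "E i"] transpose_E E_idem)
  also have "\<dots> = ?m / real w"
    using assms by (simp add: inner_matmul_left transpose_E E_idem D_inner_E)
  finally have XE: "?X \<bullet> E i = ?m / real w" .
  have "(?X - (1 / real w) *\<^sub>R E i) \<bullet> (?X - (1 / real w) *\<^sub>R E i)
      = ?X \<bullet> ?X - (2 / real w) * (?X \<bullet> E i) + (E i \<bullet> E i) / (real w)\<^sup>2"
    by (simp add: inner_diff_left inner_diff_right inner_commute power2_eq_square)
  also have "\<dots> = 0"
    unfolding XX XE using w_gt_1 by (simp add: mult_of_def power2_eq_square field_simps)
  finally show ?thesis by simp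
qed

lemma bd_off_zero:
  assumes "bd M = M" "U \<in> \<F>" "V \<in> \<F>" "U \<noteq> V" shows "D U ** M ** D V = 0"
proof -
  have "D U ** M ** D V = M ** (D U ** D V)"
    using assms by (simp add: bd_commute_D matrix_mul_assoc)
  then show ?thesis using assms by (simp add: D_orthogonal)
qed

section \<open>Products of off-diagonal blocks in a Q-antipodal scheme\<close>

context
  assumes Qpoly: "Q_polynomial_ordering d R E"
    and antipodal: "real n *\<^sub>R (E 0 + E d) = F"
begin

lemma antipodal_sim_dual: assumes "i \<le> d" shows "sim (d - i) i"
proof (cases "d - i = i")
  case False
  have "triple d (d - i) i > 0"
    using Q_polynomial_triple(2)[OF Qpoly, of "d - i" i] assms by simp
  then show ?thesis
    using triple_sim[OF antipodal, of "d - i" i] assms triple_sym False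
    by (metis diff_le_self less_irrefl)
qed (use assms sim_refl in simp)

text \<open>Distinct similar indices add up to at least \<open>d\<close>, as the Krein parameter
  with \<open>d\<close> vanishes otherwise. Applied to the pairs \<open>d - h\<close>,
  \<open>i\<close> and \<open>d - i\<close>, \<open>h\<close>, which are similar too, this gives
  both inequalities between \<open>h\<close> and \<open>i\<close>.\<close>

lemma antipodal_sim:
  assumes "h \<le> d" "i \<le> d" "sim h i" shows "h = i \<or> h = d - i"
proof (rule ccontr)
  assume ne: "\<not> (h = i \<or> h = d - i)"
  have low: "d \<le> a + b" if "a \<le> d" "b \<le> d" "a \<noteq> b" "sim a b" for a b
  proof (rule ccontr)
    assume "\<not> d \<le> a + b"
    then have "triple d a b = 0" using Q_polynomial_triple(1)[OF Qpoly] by simp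
    then show False using triple_sim[OF antipodal, of a b] that triple_sym by metis
  qed
  have "sim (d - h) i" using antipodal_sim_dual sim_trans[of "d - h" h i] assms by simp
  then have "d \<le> d - h + i" using low[of "d - h" i] assms ne by auto
  moreover have "sim (d - i) h" using antipodal_sim_dual sim_trans[of "d - i" i h] sim_sym[of h i] assms by simp
  then have "d \<le> d - i + h" using low[of "d - i" h] assms ne by auto
  ultimately show False using ne assms by auto
qed

text \<open>Here \<open>triple d i i\<close> vanishes because \<open>i + i < d\<close>, and by
  \<open>triple_al\<close> this fixes \<open>al i\<close>.\<close>

lemma antipodal_al: assumes "2 * i < d" shows "al i = 1 / real w"
proof -
  have "triple d i i = 0" using Q_polynomial_triple(1)[OF Qpoly] assms by simp
  then have "mult_of i * (al i - 1 / real w) / real n = 0"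
    using triple_al[OF antipodal, of i] triple_sym assms by (metis add_leD2 less_imp_le mult_2)
  then show ?thesis using mult_pos[of i] n_gt_1 assms by simp
qed

definition lower :: "nat \<Rightarrow> nat" where "lower k = min k (d - k)"

text \<open>The sign relating the off-diagonal blocks of \<open>E k\<close> to those of the
  representative \<open>E (lower k)\<close> of its class; it is 0 in the middle, where these blocks
  vanish.\<close>

definition side :: "nat \<Rightarrow> real" where
  "side k = (if 2 * k < d then 1 else if 2 * k = d then 0 else - 1)"

text \<open>\<open>eps k\<close> is block diagonal and is \<open>E k + E (d - k)\<close>, or just
  \<open>E k\<close> if \<open>2 * k = d\<close>. So the two summands cancel off the
  diagonal.\<close>

lemma off_E_lower:
  assumes "k \<le> d" "U \<in> \<F>" "V \<in> \<F>" "U \<noteq> V"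
  shows "D U ** E k ** D V = side k *\<^sub>R (D U ** E (lower k) ** D V)"
proof -
  have cls: "{h. h \<le> d \<and> sim h k} = {k, d - k}"
    using antipodal_sim antipodal_sim_dual sim_refl assms(1) by auto
  have zero: "D U ** eps k ** D V = 0"
    using assms bd_eps bd_off_zero by blast
  show ?thesis
  proof (cases "2 * k = d")
    case True
    then have "d - k = k" by simp
    then have "eps k = E k" using cls by (simp add: eps_def)
    then show ?thesis using zero True by (simp add: side_def)
  next
    case False
    then have "eps k = E k + E (d - k)" using cls assms(1) by (simp add: eps_def)
    then have "D U ** E k ** D V = - (D U ** E (d - k) ** D V)"
      using zero by (simp add: matmul.add_left matmul.add_right eq_neg_iff_add_eq_0)
    then show ?thesis using False by (auto simp: side_def lower_def min_def)
  qed
qed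

text \<open>Expand \<open>M\<close> and \<open>N\<close> in the idempotents and pass to lower
  indices. The middle part \<open>E a ** D V ** E b\<close> is then \<open>E a\<close> divided by
  \<open>w\<close>, or 0, so that \<open>V\<close> disappears.\<close>

lemma antipodal_product:
  assumes "M \<in> BM" "N \<in> BM"
  shows "\<exists>K\<in>BM. \<forall>U\<in>\<F>. \<forall>V\<in>\<F>. \<forall>W\<in>\<F>. U \<noteq> V \<longrightarrow> V \<noteq> W \<longrightarrow>
    D U ** M ** D V ** N ** D W = D U ** K ** D W"
proof -
  define g where "g k l = (if lower k = lower l then side k * side l / real w else 0)" for k l
  have E: "D U ** E k ** D V ** E l ** D W = g k l *\<^sub>R (D U ** E (lower k) ** D W)"
    if kl: "k \<le> d" "l \<le> d" and UVW: "U \<in> \<F>" "V \<in> \<F>" "W \<in> \<F>" "U \<noteq> V" "V \<noteq> W" for k l U V W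
  proof (cases "2 * k = d \<or> 2 * l = d")
    case True
    have "D U ** E k ** D V = 0 \<or> D V ** E l ** D W = 0"
      using off_E_lower kl UVW True by (auto simp: side_def)
    moreover have "D U ** E k ** D V ** E l ** D W = D U ** E k ** (D V ** E l ** D W)"
      by (simp add: matrix_mul_assoc)
    ultimately have "D U ** E k ** D V ** E l ** D W = 0" by auto
    then show ?thesis using True by (auto simp: g_def side_def)
  next
    case False
    let ?a = "lower k" and ?b = "lower l"
    have ab: "2 * ?a < d" "2 * ?b < d" using kl False by (auto simp: lower_def)
    have "E ?a ** D V ** E ?b = (if ?a = ?b then (1 / real w) *\<^sub>R E ?a else 0)"
    proof (cases "?a = ?b")
      case True
      then show ?thesis using E_D_E[of ?a V] antipodal_al[OF ab(1)] ab UVW by simp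
    next
      case False
      then have "\<not> sim ?a ?b" using antipodal_sim[of ?a ?b] ab by auto
      then show ?thesis using False UVW by (simp add: sim_def)
    qed
    then have mid: "D U ** (E ?a ** D V ** E ?b) ** D W
        = (if ?a = ?b then 1 / real w else 0) *\<^sub>R (D U ** E ?a ** D W)"
      by (simp add: matmul.scaleR_left matmul.scaleR_right)
    have "D U ** E k ** D V ** E l ** D W = (D U ** E k ** D V) ** (D V ** E l ** D W)"
      using D_mult_D[of "D U ** E k" V "E l ** D W"] by (simp only: matrix_mul_assoc)
    also have "\<dots> = (side k * side l) *\<^sub>R ((D U ** E ?a ** D V) ** (D V ** E ?b ** D W))"
      using off_E_lower kl UVW by (simp add: matmul.scaleR_left matmul.scaleR_right)
    also have "(D U ** E ?a ** D V) ** (D V ** E ?b ** D W) = D U ** (E ?a ** D V ** E ?b) ** D W"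
      using D_mult_D[of "D U ** E ?a" V "E ?b ** D W"] by (simp only: matrix_mul_assoc)
    finally show ?thesis unfolding mid g_def by simp
  qed
  define K where "K = (\<Sum>k\<le>d. \<Sum>l\<le>d. (ev M k * ev N l * g k l) *\<^sub>R E (lower k))"
  have "K \<in> BM"
    unfolding K_def
    by (intro subspace_sum[OF BM_subspace] subspace_scale[OF BM_subspace] E_in_BM)
      (auto simp: lower_def)
  moreover have "D U ** M ** D V ** N ** D W = D U ** K ** D W"
    if UVW: "U \<in> \<F>" "V \<in> \<F>" "W \<in> \<F>" "U \<noteq> V" "V \<noteq> W" for U V W
  proof -
    have "D U ** M ** D V ** N ** D W =
       D U ** (\<Sum>k\<le>d. ev M k *\<^sub>R E k) ** D V ** (\<Sum>l\<le>d. ev N l *\<^sub>R E l) ** D W"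
      using BM_expand[OF assms(1)] BM_expand[OF assms(2)] by simp
    also have "\<dots> = (\<Sum>k\<le>d. \<Sum>l\<le>d. (ev M k * ev N l) *\<^sub>R (D U ** E k ** D V ** E l ** D W))"
      by (simp add: matmul.sum_left matmul.sum_right matmul.scaleR_left matmul.scaleR_right
          scaleR_sum_right) (subst sum.swap, simp add: mult.commute)
    also have "\<dots> = (\<Sum>k\<le>d. \<Sum>l\<le>d. (ev M k * ev N l * g k l) *\<^sub>R (D U ** E (lower k) ** D W))"
      using UVW by (intro sum.cong refl) (simp add: E)
    also have "\<dots> = D U ** K ** D W"
      by (simp add: K_def matmul.sum_left matmul.sum_right matmul.scaleR_left matmul.scaleR_right)
    finally show ?thesis .
  qed
  ultimately show ?thesis by blast
qed

lemma antipodal_uniform: "uniform_wrt d R \<F> \<I>"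
proof (rule uniform_wrtI)
  fix i j assume "i \<in> {..d} - \<I>" "j \<in> {..d} - \<I>"
  then show "\<exists>K\<in>BM. \<forall>U\<in>\<F>. \<forall>V\<in>\<F>. \<forall>W\<in>\<F>. U \<noteq> V \<longrightarrow> V \<noteq> W \<longrightarrow>
      block (rel_matrix (R i)) U V ** block (rel_matrix (R j)) V W = block K U W"
    unfolding block_mult_eq unfolding block_eq by (intro antipodal_product rel_matrix_in_BM) auto
qed

end

section \<open>Uniform schemes\<close>

lemma off_expand:
  assumes "M \<in> BM" "bd M = 0"
  shows "\<exists>c. M = (\<Sum>i\<in>{..d} - \<I>. c i *\<^sub>R rel_matrix (R i))"
proof -
  obtain c where c: "\<And>i x y. i \<le> d \<Longrightarrow> (x, y) \<in> R i \<Longrightarrow> M $ x $ y = c i"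
    using assms(1) unfolding BM_iff by metis
  have "M = (\<Sum>i\<in>{..d} - \<I>. c i *\<^sub>R rel_matrix (R i))"
    unfolding vec_eq_iff
  proof (intro allI)
    fix x y
    obtain h where h: "h \<le> d" "(x, y) \<in> R h" by (rule relation_exists)
    have "bd M $ x $ y = 0" using assms(2) by simp
    then have "h \<in> \<I> \<Longrightarrow> M $ x $ y = 0" using F_relation[OF h(2,1)] by (simp add: bd_def)
    then show "M $ x $ y = (\<Sum>i\<in>{..d} - \<I>. c i *\<^sub>R rel_matrix (R i)) $ x $ y"
      using h c by (subst sum_rel_matrix_nth[OF h(2,1)]) auto
  qed
  then show ?thesis by blast
qed

lemma eps_absorb_D:
  assumes "i \<le> d" "eps i ** M = M" "U \<in> \<F>"
  shows "eps i ** (D U ** M) = D U ** M"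
proof -
  have "eps i ** (D U ** M) = D U ** eps i ** M"
    using bd_commute_D[OF bd_eps[OF assms(1)] assms(3)] by (simp add: matrix_mul_assoc)
  then show ?thesis using assms(2) by (simp add: matrix_mul_assoc[symmetric])
qed

section \<open>Block products, similarity classes and eigenvalues under uniformity\<close>

context
  assumes uniform: "uniform_wrt d R \<F> \<I>"
begin

lemma uniform_indices:
  "U \<in> \<F> \<Longrightarrow> V \<in> \<F> \<Longrightarrow> U \<noteq> V \<Longrightarrow> fibre_indices d R U V = {..d} - \<I>"
  using uniform by (simp add: uniform_wrt_def)

text \<open>Bilinear extension of the uniformity axiom: vanishing \<open>bd\<close> confines both
  expansions to relations outside \<open>\<I>\<close>, and these occur between any two distinct
  fibres.\<close>

lemma uniform_product:
  assumes "M \<in> BM" "N \<in> BM" "bd M = 0" "bd N = 0"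
  obtains K where "K \<in> BM" "\<And>U V W. U \<in> \<F> \<Longrightarrow> V \<in> \<F> \<Longrightarrow> W \<in> \<F> \<Longrightarrow> U \<noteq> V \<Longrightarrow> V \<noteq> W \<Longrightarrow>
    D U ** M ** D V ** N ** D W = D U ** K ** D W"
proof -
  let ?A = "\<lambda>i. rel_matrix (R i)" and ?O = "{..d} - \<I>"
  obtain c where c: "M = (\<Sum>i\<in>?O. c i *\<^sub>R ?A i)"
    using off_expand[OF assms(1,3)] by (rule exE)
  obtain e where e: "N = (\<Sum>i\<in>?O. e i *\<^sub>R ?A i)"
    using off_expand[OF assms(2,4)] by (rule exE)
  obtain a :: "nat \<Rightarrow> nat \<Rightarrow> nat \<Rightarrow> int" where a: "\<forall>U\<in>\<F>. \<forall>V\<in>\<F>. \<forall>W\<in>\<F>.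
        \<forall>i\<in>fibre_indices d R U V. \<forall>j\<in>fibre_indices d R V W.
          block (?A i) U V ** block (?A j) V W =
          (\<Sum>h\<le>d. real_of_int (a h i j) *\<^sub>R block (?A h) U W)"
    using uniform unfolding uniform_wrt_def by (elim conjE exE)
  define L where "L i j = (\<Sum>h\<le>d. real_of_int (a h i j) *\<^sub>R ?A h)" for i j
  define K where "K = (\<Sum>i\<in>?O. \<Sum>j\<in>?O. (c i * e j) *\<^sub>R L i j)"
  have "K \<in> BM"
    unfolding K_def L_def
    by (intro subspace_sum[OF BM_subspace] subspace_scale[OF BM_subspace] rel_matrix_in_BM) simp
  moreover have "D U ** M ** D V ** N ** D W = D U ** K ** D W"
    if UVW: "U \<in> \<F>" "V \<in> \<F>" "W \<in> \<F>" "U \<noteq> V" "V \<noteq> W" for U V W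
  proof -
    have step: "D U ** ?A i ** D V ** ?A j ** D W = D U ** L i j ** D W" if "i \<in> ?O" "j \<in> ?O" for i j
    proof -
      have "block (?A i) U V ** block (?A j) V W = (\<Sum>h\<le>d. real_of_int (a h i j) *\<^sub>R block (?A h) U W)"
        using a UVW that uniform_indices by simp
      then have "D U ** ?A i ** D V ** ?A j ** D W
          = (\<Sum>h\<le>d. real_of_int (a h i j) *\<^sub>R block (?A h) U W)"
        unfolding block_mult_eq .
      then show ?thesis
        by (simp add: L_def block_eq matmul.sum_left matmul.sum_right
            matmul.scaleR_left matmul.scaleR_right)
    qed
    have "D U ** M ** D V ** N ** D W
        = (\<Sum>j\<in>?O. \<Sum>i\<in>?O. (c i * e j) *\<^sub>R (D U ** ?A i ** D V ** ?A j ** D W))"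
      unfolding c e
      by (simp add: matmul.sum_left matmul.sum_right matmul.scaleR_left matmul.scaleR_right
          scaleR_sum_right mult.commute)
    also have "\<dots> = (\<Sum>i\<in>?O. \<Sum>j\<in>?O. (c i * e j) *\<^sub>R (D U ** ?A i ** D V ** ?A j ** D W))"
      by (rule sum.swap)
    also have "\<dots> = (\<Sum>i\<in>?O. \<Sum>j\<in>?O. (c i * e j) *\<^sub>R (D U ** L i j ** D W))"
      by (intro sum.cong refl) (simp only: step)
    also have "\<dots> = D U ** K ** D W"
      by (simp add: K_def matmul.sum_left matmul.sum_right matmul.scaleR_left matmul.scaleR_right)
    finally show ?thesis .
  qed
  ultimately show ?thesis by (rule that)
qed

text \<open>\<open>F\<close> is \<open>n\<close> times a sum of idempotents \<open>E k\<close>, one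
  of them \<open>E 0\<close>. Any further \<open>E j\<close> among them is constant on blocks;
  uniformity forces a single value between distinct fibres, which puts \<open>E j\<close> in the
  span of \<open>F\<close> and \<open>E 0\<close>.\<close>

lemma uniform_antipodal_index:
  obtains j where "0 < j" "j \<le> d" "real n *\<^sub>R (E 0 + E j) = F"
proof -
  define v where "v = real CARD('a)"
  have v: "v > 0" by (simp add: v_def)
  have n: "real n > 0" using n_gt_1 by simp
  have evF: "ev F k = 0 \<or> ev F k = real n" if "k \<le> d" for k
  proof -
    have "ev F k * ev F k = real n * ev F k"
      using ev_mult[OF F_in_BM F_in_BM that] unfolding F_square ev_linear by (rule sym)
    then show ?thesis by (metis mult_right_cancel)
  qed
  have "F ** E 0 = real n *\<^sub>R E 0"
    unfolding vec_eq_iff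
  proof (intro allI)
    fix x y
    obtain U where "U \<in> \<F>" "x \<in> U" by (rule fibre_exists)
    then show "(F ** E 0) $ x $ y = (real n *\<^sub>R E 0) $ x $ y"
      using F_mult_nth[of U x "E 0" y] by (simp add: E_0_nth card_fibre)
  qed
  then have ev0: "ev F 0 = real n"
    using E_mult_BM(2)[OF F_in_BM, of 0] E_nonzero[of 0] by (metis le0 scaleR_cancel_right)
  have "\<exists>j\<le>d. j \<noteq> 0 \<and> ev F j = real n"
  proof (rule ccontr)
    assume "\<not> ?thesis"
    \<comment> \<open>The multiple of \<open>E 0\<close> has no zero entry, whereas \<open>F\<close>
      vanishes between distinct fibres.\<close>
    then have "F = real n *\<^sub>R E 0"
      using evF ev0 by (intro BM_eqI F_in_BM subspace_scale[OF BM_subspace] E_in_BM)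
        (auto simp: ev_linear ev_E)
    moreover obtain U where U: "U \<in> \<F>" by (rule other_fibre)
    moreover obtain V where V: "V \<in> \<F>" "V \<noteq> U" by (rule other_fibre)
    moreover obtain x y where "x \<in> U" "y \<in> V" using U V fibre_nonempty by metis
    ultimately show False using F_nth[of U V x y] n by (simp add: E_0_nth)
  qed
  then obtain j where j: "j \<le> d" "j \<noteq> 0" "ev F j = real n" by blast
  have FE: "F ** E j = real n *\<^sub>R E j" using E_mult_BM(2)[OF F_in_BM] j by simp
  \<comment> \<open>\<open>F ** E j\<close> sums columns over fibres, so every entry of
    \<open>E j\<close> is an average over a fibre.\<close>
  have const1: "E j $ x $ y = E j $ x' $ y" if "U \<in> \<F>" "x \<in> U" "x' \<in> U" for U x x' y
  proof -
    have "real n * E j $ x $ y = real n * E j $ x' $ y"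
      using F_mult_nth[OF that(1,2), of "E j" y] F_mult_nth[OF that(1,3), of "E j" y] FE by simp
    then show ?thesis using n by simp
  qed
  have const: "E j $ x $ y = E j $ x' $ y'" if "U \<in> \<F>" "V \<in> \<F>" "x \<in> U" "x' \<in> U" "y \<in> V" "y' \<in> V"
    for U V x x' y y'
    using const1[of U x x' y] const1[of V y y' x'] that BM_symmetric[OF E_in_BM[OF j(1)]] by metis
  obtain c where c: "\<And>i x y. i \<le> d \<Longrightarrow> (x, y) \<in> R i \<Longrightarrow> E j $ x $ y = c i"
    using E_in_BM[OF j(1)] unfolding BM_iff by metis
  obtain U0 where U0: "U0 \<in> \<F>" by (rule other_fibre)
  obtain V0 where V0: "V0 \<in> \<F>" "V0 \<noteq> U0" by (rule other_fibre)
  obtain x0 y0 where xy0: "x0 \<in> U0" "y0 \<in> V0" using U0 V0 fibre_nonempty by metis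
  define b where "b = E j $ x0 $ y0"
  \<comment> \<open>Every relation outside \<open>\<I>\<close> is met in the single block
    \<open>U0 \<times> V0\<close>, on which \<open>E j\<close> is constant.\<close>
  have off: "c h = b" if "h \<le> d" "h \<notin> \<I>" for h
  proof -
    have "h \<in> fibre_indices d R U0 V0" using uniform_indices U0 V0 that by auto
    then obtain x y where "(x, y) \<in> R h" "x \<in> U0" "y \<in> V0" by (auto simp: fibre_indices_def)
    then show ?thesis using c[of h x y] const[of U0 V0 x x0 y y0] U0 V0 xy0 that by (simp add: b_def)
  qed
  have entries: "E j = (c 0 - b) *\<^sub>R F + (b * v) *\<^sub>R E 0"
    unfolding vec_eq_iff
  proof (intro allI)
    fix x y
    obtain h where h: "h \<le> d" "(x, y) \<in> R h" by (rule relation_exists)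
    obtain U V where UV: "U \<in> \<F>" "x \<in> U" "V \<in> \<F>" "y \<in> V" by (metis fibre_exists)
    have "E j $ x $ y = (if U = V then c 0 else b)"
    proof (cases "U = V")
      case True
      then have "E j $ x $ y = E j $ x $ x" using const[of U U x x y x] UV by simp
      then show ?thesis using True c[of 0 x x] relation_0 by simp
    next
      case False
      then show ?thesis using relation_in_I[OF h(2,1) UV(1,3,2,4)] off c[of h x y] h by simp
    qed
    then show "E j $ x $ y = ((c 0 - b) *\<^sub>R F + (b * v) *\<^sub>R E 0) $ x $ y"
      using F_nth[OF UV(1,3,2,4)] v by (simp add: E_0_nth v_def)
  qed
  \<comment> \<open>Comparing coefficients of \<open>E k\<close> in \<open>entries\<close> would
    give \<open>c 0 = b\<close>, making \<open>E j\<close> a multiple of \<open>E 0\<close>.\<close>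
  have others: "ev F k = 0" if "k \<le> d" "k \<noteq> 0" "k \<noteq> j" for k
  proof (rule ccontr)
    assume "ev F k \<noteq> 0"
    moreover have "(c 0 - b) * ev F k = 0"
      using ev_E[of j k] ev_E[of 0 k] that j arg_cong[OF entries, of "\<lambda>M. ev M k"]
      by (simp add: ev_linear)
    ultimately have "E j = (b * v) *\<^sub>R E 0" using entries by simp
    then have "ev (E j) j = b * v * ev (E 0) j" by (metis ev_linear(3))
    then show False using j by (simp add: ev_E)
  qed
  have "real n *\<^sub>R (E 0 + E j) = F"
    using j ev0 others
    by (intro BM_eqI F_in_BM subspace_scale[OF BM_subspace] subspace_add[OF BM_subspace] E_in_BM)
      (auto simp: ev_linear ev_E)
  then show ?thesis using that[of j] j by simp
qed

text \<open>The product lies in a diagonal block, so \<open>K\<close> may be replaced by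
  \<open>bd K\<close>; on one similarity class a block diagonal element of \<open>BM\<close> acts as
  a scalar.\<close>

lemma uniform_off_pair:
  assumes "i \<le> d" "M \<in> BM" "N \<in> BM" "bd M = 0" "bd N = 0" "eps i ** M = M"
  obtains c where "\<And>U V. U \<in> \<F> \<Longrightarrow> V \<in> \<F> \<Longrightarrow> U \<noteq> V \<Longrightarrow>
    D U ** M ** D V ** N ** D U = c *\<^sub>R (D U ** eps i)"
proof -
  obtain K where K: "K \<in> BM" "\<And>U V W. U \<in> \<F> \<Longrightarrow> V \<in> \<F> \<Longrightarrow> W \<in> \<F> \<Longrightarrow> U \<noteq> V \<Longrightarrow> V \<noteq> W \<Longrightarrow>
      D U ** M ** D V ** N ** D W = D U ** K ** D W"
    using uniform_product[OF assms(2-5)] by metis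
  have L: "eps i ** bd K = ev (bd K) i *\<^sub>R eps i"
  proof (rule BM_eqI)
    fix h assume "h \<le> d"
    then show "ev (eps i ** bd K) h = ev (ev (bd K) i *\<^sub>R eps i) h"
      using ev_sim[of h i "bd K"] assms(1) K(1)
      by (simp add: ev_mult ev_linear ev_eps eps_in_BM bd_in_BM bd_bd)
  qed (use K in \<open>auto intro!: mult_in_BM eps_in_BM bd_in_BM\<close>)
  show ?thesis
  proof (rule that)
    fix U V assume UV: "U \<in> \<F>" "V \<in> \<F>" "U \<noteq> V"
    have "D U ** M ** D V ** N ** D U = eps i ** (D U ** M) ** D V ** N ** D U"
      using eps_absorb_D[OF assms(1,6) UV(1)] by simp
    also have "\<dots> = eps i ** (D U ** M ** D V ** N ** D U)" by (simp only: matrix_mul_assoc)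
    also have "\<dots> = eps i ** (D U ** bd K)" using K(2)[of U V U] UV by (simp add: D_bd)
    also have "\<dots> = D U ** (eps i ** bd K)"
      using bd_commute_D[OF bd_eps[OF assms(1)] UV(1)] by (simp add: matrix_mul_assoc)
    finally show "D U ** M ** D V ** N ** D U = ev (bd K) i *\<^sub>R (D U ** eps i)"
      by (simp add: L matmul.scaleR_right)
  qed
qed

text \<open>Within one similarity class the matrices of \<open>BM\<close> without diagonal blocks
  form a space of dimension at most one.\<close>

lemma uniform_off_proportional:
  assumes "i \<le> d" "M \<in> BM" "N \<in> BM" "bd M = 0" "bd N = 0" "eps i ** M = M" "eps i ** N = N" "M \<noteq> 0"
  obtains t where "N = t *\<^sub>R M"
proof -
  obtain c where c: "\<And>U V. U \<in> \<F> \<Longrightarrow> V \<in> \<F> \<Longrightarrow> U \<noteq> V \<Longrightarrow>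
      D U ** M ** D V ** M ** D U = c *\<^sub>R (D U ** eps i)"
    using uniform_off_pair[OF assms(1,2,2,4,4,6)] by metis
  obtain c' where c': "\<And>U V. U \<in> \<F> \<Longrightarrow> V \<in> \<F> \<Longrightarrow> U \<noteq> V \<Longrightarrow>
      D U ** N ** D V ** M ** D U = c' *\<^sub>R (D U ** eps i)"
    using uniform_off_pair[OF assms(1,3,2,5,4,7)] by metis
  have "c \<noteq> 0"
  proof
    assume "c = 0"
    have "M = 0"
    proof (rule off_diagonal_eqI)
      fix U V assume UV: "U \<in> \<F>" "V \<in> \<F>" "U \<noteq> V"
      let ?X = "D U ** M ** D V"
      have "transpose ?X = D V ** M ** D U"
        using assms(2) by (simp add: matrix_transpose_mul transpose_BM transpose_fibre_proj matrix_mul_assoc)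
      then have "?X ** transpose ?X = D U ** M ** D V ** M ** D U"
        using D_mult_D[of "D U ** M" V "M ** D U"] by (simp add: matrix_mul_assoc)
      then have "?X ** transpose ?X = 0" using c[OF UV] \<open>c = 0\<close> by simp
      then have "?X \<bullet> ?X = 0" using inner_matmul_right[of "mat 1" ?X ?X] by simp
      then show "?X = D U ** 0 ** D V" by simp
    qed (use assms(4) in \<open>simp add: bd_def vec_eq_iff\<close>)
    then show False using assms(8) by simp
  qed
  \<comment> \<open>Chosen so that the products of blocks of \<open>Z\<close> and \<open>M\<close>
    returning to the same fibre cancel. A further factor \<open>M\<close> returns a multiple of
    \<open>Z\<close>, since blocks of \<open>M\<close> are invertible on the class up to the scalar
    \<open>c\<close>.\<close>
  define t where "t = c' / c"
  define Z where "Z = N - t *\<^sub>R M"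
  have epsZ: "Z ** eps i = Z"
    using assms BM_commute[OF _ eps_in_BM]
    by (simp add: Z_def matmul.diff_left matmul.scaleR_left)
  have "Z = 0"
  proof (rule off_diagonal_eqI)
    show "bd Z = bd 0" using assms(4,5) by (simp add: Z_def bd_linear) (simp add: bd_def vec_eq_iff)
    fix U V assume UV: "U \<in> \<F>" "V \<in> \<F>" "U \<noteq> V"
    have "D U ** Z ** D V ** M ** D U = 0"
      using c[OF UV] c'[OF UV] \<open>c \<noteq> 0\<close>
      by (simp add: Z_def t_def matmul.diff_left matmul.diff_right matmul.scaleR_left matmul.scaleR_right)
    then have "0 = (D U ** Z ** D V ** M ** D U) ** (M ** D V)" by simp
    also have "\<dots> = D U ** Z ** D V ** (D V ** M ** D U ** M ** D V)"
      using D_mult_D[of "D U ** Z" V "M ** D U ** M ** D V"] by (simp add: matrix_mul_assoc)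
    also have "\<dots> = c *\<^sub>R (D U ** Z ** D V ** (D V ** eps i))"
      using c[of V U] UV by (simp add: matmul.scaleR_right)
    also have "D U ** Z ** D V ** (D V ** eps i) = D U ** Z ** (D V ** eps i)"
      using D_mult_D[of "D U ** Z" V "eps i"] by (simp add: matrix_mul_assoc)
    also have "\<dots> = D U ** (Z ** eps i) ** D V"
      using bd_commute_D[OF bd_eps[OF assms(1)] UV(2)] by (simp add: matrix_mul_assoc)
    finally show "D U ** Z ** D V = D U ** 0 ** D V" using \<open>c \<noteq> 0\<close> by (simp add: epsZ)
  qed
  then show ?thesis using that[of t] by (simp add: Z_def)
qed

text \<open>For \<open>a \<le> d\<close> this is \<open>E a - bd (E a)\<close>, the part of
  \<open>E a\<close> between distinct fibres.\<close>

definition off :: "nat \<Rightarrow> real^'a^'a" where "off a = E a - al a *\<^sub>R eps a"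

lemma off_props:
  assumes "a \<le> d"
  shows "off a \<in> BM" "bd (off a) = 0" "eps a ** off a = off a"
    and "h \<le> d \<Longrightarrow> ev (off a) h = (if h = a then 1 else 0) - (if sim h a then al a else 0)"
proof -
  show BM: "off a \<in> BM"
    unfolding off_def using assms E_in_BM eps_in_BM by blast
  show "bd (off a) = 0" using assms by (simp add: off_def bd_linear bd_E bd_eps)
  show ev: "ev (off a) h = (if h = a then 1 else 0) - (if sim h a then al a else 0)" if "h \<le> d" for h
    using assms that by (simp add: off_def ev_linear ev_E ev_eps)
  show "eps a ** off a = off a"
    by (rule BM_eqI) (use assms BM sim_refl in \<open>auto simp: mult_in_BM eps_in_BM ev_mult ev_eps ev\<close>)
qed

text \<open>With three distinct members, \<open>off a\<close> and \<open>off b\<close> are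
  proportional. Their eigenvalues at \<open>c\<close> and at \<open>a\<close> give factors that
  agree only if \<open>al b = 0\<close>.\<close>

lemma uniform_class_size:
  assumes "a \<le> d" "b \<le> d" "c \<le> d" "sim b a" "sim c a" shows "a = b \<or> a = c \<or> b = c"
proof (rule ccontr)
  assume ne: "\<not> ?thesis"
  have ab: "sim a b" "sim c b" using assms sim_sym[of b a] sim_trans[of c a b] by auto
  have epsb: "eps b = eps a" using assms eps_sim by blast
  have "ev (off a) c \<noteq> 0" using off_props(4)[of a c] assms ne al_pos[of a] by simp
  then have "off a \<noteq> 0" by (auto simp: ev_def)
  then obtain t where t: "off b = t *\<^sub>R off a"
    using uniform_off_proportional[of a "off a" "off b"] off_props(1-3)[of a] off_props(1-3)[of b] assms epsb
    by metis
  have "ev (off b) c = t * ev (off a) c" "ev (off b) a = t * ev (off a) a"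
    by (simp_all add: t ev_linear)
  then have "al b = t * al a" "- al b = t * (1 - al a)"
    using off_props(4)[of a] off_props(4)[of b] assms ne ab sim_refl by auto
  then have "t = - (t * al a) + t * al a" by (simp add: algebra_simps)
  then have "al b = 0" using \<open>al b = t * al a\<close> by simp
  then show False using al_pos[of b] assms by simp
qed

text \<open>A walk of two steps through blocks of \<open>M = off a\<close> gives a constant
  \<open>c\<close> if it returns and a factor \<open>k\<close> if it does not. Summing over the
  middle fibre and comparing with the quadratic equation of \<open>M\<close> determines both;
  \<open>c = k * k\<close> then leaves two values.\<close>

lemma uniform_pair_al:
  assumes "a \<le> d" "b \<le> d" "a \<noteq> b" "sim b a"
  shows "al a = 1 / real w \<or> al a = 1 - 1 / real w"
proof -
  define M where "M = off a"
  define \<alpha> where "\<alpha> = al a"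
  note P = off_props[OF assms(1), folded M_def \<alpha>_def]
  have cls: "{h. h \<le> d \<and> sim h a} = {a, b}"
    using uniform_class_size[OF assms(1,2)] assms sim_refl by blast
  have "\<alpha> + al b = 1" using sum_al[OF assms(1)] assms by (simp add: cls \<alpha>_def)
  then have \<alpha>: "0 < \<alpha>" "\<alpha> < 1" using al_pos[of a] al_pos[of b] assms by (auto simp: \<alpha>_def)
  have "ev M a \<noteq> 0" using P(4)[of a] assms \<alpha> sim_refl by simp
  then have "M \<noteq> 0" by (auto simp: ev_def)
  \<comment> \<open>The eigenvalues of \<open>M\<close> on the class \<open>{a, b}\<close> are
    \<open>1 - \<alpha>\<close> and \<open>- \<alpha>\<close>, with sum
    \<open>1 - 2 * \<alpha>\<close> and product \<open>\<alpha>\<^sup>2 - \<alpha>\<close>.\<close>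
  have MM: "M ** M = (1 - 2 * \<alpha>) *\<^sub>R M + (\<alpha> - \<alpha>\<^sup>2) *\<^sub>R eps a"
  proof (rule BM_eqI)
    fix h assume h: "h \<le> d"
    have "sim h a \<longleftrightarrow> h = a \<or> h = b" using cls h assms by blast
    then show "ev (M ** M) h = ev ((1 - 2 * \<alpha>) *\<^sub>R M + (\<alpha> - \<alpha>\<^sup>2) *\<^sub>R eps a) h"
      unfolding ev_mult[OF P(1) P(1) h] ev_linear P(4)[OF h] ev_eps[OF h]
      using assms(3) by (simp add: power2_eq_square algebra_simps)
  next
    show "(1 - 2 * \<alpha>) *\<^sub>R M + (\<alpha> - \<alpha>\<^sup>2) *\<^sub>R eps a \<in> BM"
      using P(1) eps_in_BM by blast
  qed (simp add: P(1) mult_in_BM)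
  obtain c where c: "\<And>U V. U \<in> \<F> \<Longrightarrow> V \<in> \<F> \<Longrightarrow> U \<noteq> V \<Longrightarrow>
      D U ** M ** D V ** M ** D U = c *\<^sub>R (D U ** eps a)"
    using uniform_off_pair[OF assms(1) P(1,1,2,2,3)] by metis
  have split: "D U ** (M ** M) ** D W = (\<Sum>V\<in>\<F> - {U, W}. D U ** M ** D V ** M ** D W)"
    if "U \<in> \<F>" "W \<in> \<F>" for U W
  proof -
    have zero: "D V ** M ** D V = 0" if "V \<in> \<F>" for V
      using D_bd[OF that, of M] P(2) by simp
    have "D U ** (M ** M) ** D W = D U ** M ** (\<Sum>V\<in>\<F>. D V) ** M ** D W"
      by (simp add: sum_D matrix_mul_assoc)
    also have "\<dots> = (\<Sum>V\<in>\<F>. D U ** M ** D V ** M ** D W)"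
      by (simp add: matmul.sum_left matmul.sum_right)
    also have "\<dots> = (\<Sum>V\<in>\<F> - {U, W}. D U ** M ** D V ** M ** D W)"
    proof (rule sum.mono_neutral_right)
      show "\<forall>V\<in>\<F> - (\<F> - {U, W}). D U ** M ** D V ** M ** D W = 0"
      proof
        fix V assume "V \<in> \<F> - (\<F> - {U, W})"
        then consider "V = U" | "V = W" by blast
        then show "D U ** M ** D V ** M ** D W = 0"
        proof cases
          case 1
          then show ?thesis using zero[OF that(1)] by simp
        next
          case 2
          have "D U ** M ** D W ** M ** D W = D U ** M ** (D W ** M ** D W)"
            by (simp only: matrix_mul_assoc)
          then show ?thesis using 2 zero[OF that(2)] by simp
        qed
      qed
    qed (use finite_fibres in auto)
    finally show ?thesis .
  qed
  have "(real (w - 1) * c) *\<^sub>R eps a = (\<alpha> - \<alpha>\<^sup>2) *\<^sub>R eps a"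
  proof (rule D_eqI)
    fix U assume U: "U \<in> \<F>"
    have "D U ** (M ** M) ** D U = (\<Sum>V\<in>\<F> - {U, U}. c *\<^sub>R (D U ** eps a))"
      unfolding split[OF U U] using c U by (intro sum.cong) auto
    also have "\<dots> = (real (w - 1) * c) *\<^sub>R (D U ** eps a)"
      unfolding sum_constant_scaleR using U card_fibres by simp
    finally have "(real (w - 1) * c) *\<^sub>R (D U ** eps a) = D U ** bd (M ** M)" using U by (simp add: D_bd)
    also have "bd (M ** M) = (\<alpha> - \<alpha>\<^sup>2) *\<^sub>R eps a"
      using P(2) assms by (simp add: MM bd_linear bd_eps)
    finally show "D U ** ((real (w - 1) * c) *\<^sub>R eps a) = D U ** ((\<alpha> - \<alpha>\<^sup>2) *\<^sub>R eps a)"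
      by (simp add: matmul.scaleR_right)
  qed
  then have "ev ((real (w - 1) * c) *\<^sub>R eps a) a = ev ((\<alpha> - \<alpha>\<^sup>2) *\<^sub>R eps a) a"
    by (simp only:)
  then have eq1: "real (w - 1) * c = \<alpha> - \<alpha>\<^sup>2"
    using assms sim_refl by (simp add: ev_linear ev_eps)
  obtain K where K: "K \<in> BM" "\<And>U V W. U \<in> \<F> \<Longrightarrow> V \<in> \<F> \<Longrightarrow> W \<in> \<F> \<Longrightarrow> U \<noteq> V \<Longrightarrow> V \<noteq> W \<Longrightarrow>
      D U ** M ** D V ** M ** D W = D U ** K ** D W"
    using uniform_product[OF P(1,1,2,2)] by metis
  \<comment> \<open>The part of \<open>K\<close> lying in the class of \<open>a\<close> and off the
    diagonal blocks; \<open>uniform_off_proportional\<close> makes it a multiple of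
    \<open>M\<close>.\<close>
  define L where "L = eps a ** (K - bd K)"
  have L: "L \<in> BM" "bd L = 0" "eps a ** L = L"
  proof -
    show "L \<in> BM" unfolding L_def
      by (intro mult_in_BM eps_in_BM subspace_diff[OF BM_subspace] bd_in_BM K(1))
    show "bd L = 0" using bd_mult[OF bd_eps[OF assms(1)]] by (simp add: L_def bd_linear bd_bd)
    have "eps a ** eps a = eps a"
      by (rule BM_eqI) (auto simp: mult_in_BM eps_in_BM ev_mult ev_eps)
    then show "eps a ** L = L" by (simp add: L_def matrix_mul_assoc)
  qed
  obtain k where k: "L = k *\<^sub>R M"
    using uniform_off_proportional[OF assms(1) P(1) L(1) P(2) L(2) P(3) L(3) \<open>M \<noteq> 0\<close>] by metis
  have k_prod: "D U ** M ** D V ** M ** D W = k *\<^sub>R (D U ** M ** D W)"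
    if UVW: "U \<in> \<F>" "V \<in> \<F>" "W \<in> \<F>" "U \<noteq> V" "V \<noteq> W" "U \<noteq> W" for U V W
  proof -
    have "D U ** bd K ** D W = 0" using bd_off_zero[OF bd_bd UVW(1,3,6)] .
    then have K': "D U ** K ** D W = D U ** (K - bd K) ** D W"
      by (simp add: matmul.diff_left matmul.diff_right)
    have "D U ** M ** D V ** M ** D W = eps a ** (D U ** M) ** D V ** M ** D W"
      using eps_absorb_D[OF assms(1) P(3) UVW(1)] by simp
    also have "\<dots> = eps a ** (D U ** M ** D V ** M ** D W)" by (simp only: matrix_mul_assoc)
    also have "\<dots> = eps a ** (D U ** (K - bd K) ** D W)" using K(2) UVW K' by simp
    also have "\<dots> = D U ** L ** D W"
      using bd_commute_D[OF bd_eps[OF assms(1)] UVW(1)] by (simp add: L_def matrix_mul_assoc)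
    finally show ?thesis by (simp add: k matmul.scaleR_left matmul.scaleR_right)
  qed
  have off_cancel: "s = t"
    if "\<And>U W. U \<in> \<F> \<Longrightarrow> W \<in> \<F> \<Longrightarrow> U \<noteq> W \<Longrightarrow> s *\<^sub>R (D U ** M ** D W) = t *\<^sub>R (D U ** M ** D W)" for s t
  proof -
    have "s *\<^sub>R M = t *\<^sub>R M"
      by (rule off_diagonal_eqI)
        (use that P(2) in \<open>auto simp: bd_linear matmul.scaleR_left matmul.scaleR_right\<close>)
    then show ?thesis using \<open>M \<noteq> 0\<close> by simp
  qed
  have eq2: "real (w - 2) * k = 1 - 2 * \<alpha>"
  proof (rule off_cancel)
    fix U W assume UW: "U \<in> \<F>" "W \<in> \<F>" "U \<noteq> W"
    have "D U ** (M ** M) ** D W = (\<Sum>V\<in>\<F> - {U, W}. k *\<^sub>R (D U ** M ** D W))"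
      unfolding split[OF UW(1,2)] using k_prod UW by (intro sum.cong) auto
    also have "\<dots> = (real (w - 2) * k) *\<^sub>R (D U ** M ** D W)"
      unfolding sum_constant_scaleR using UW card_fibres by (simp add: card_Diff_subset numeral_2_eq_2)
    finally have "(real (w - 2) * k) *\<^sub>R (D U ** M ** D W) = D U ** (M ** M) ** D W" by simp
    also have "\<dots> = (1 - 2 * \<alpha>) *\<^sub>R (D U ** M ** D W)"
      using bd_off_zero[OF bd_eps[OF assms(1)] UW]
      by (simp add: MM matmul.add_left matmul.add_right matmul.scaleR_left matmul.scaleR_right)
    finally show "(real (w - 2) * k) *\<^sub>R (D U ** M ** D W) = (1 - 2 * \<alpha>) *\<^sub>R (D U ** M ** D W)" .
  qed
  show ?thesis
  proof (cases "w = 2")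
    case True
    then show ?thesis using eq2 by (simp add: \<alpha>_def)
  next
    case False
    then have w: "w \<ge> 3" using w_gt_1 by simp
    \<comment> \<open>The walk from \<open>U\<close> to \<open>V\<close>, back to \<open>U\<close>
      and on to \<open>W\<close> is evaluated with its two bracketings; the third fibre
      \<open>V\<close> is where \<open>w \<ge> 3\<close> enters.\<close>
    have eq3: "c = k * k"
    proof (rule off_cancel)
      fix U W assume UW: "U \<in> \<F>" "W \<in> \<F>" "U \<noteq> W"
      have "\<not> \<F> \<subseteq> {U, W}" using card_mono[of "{U, W}" \<F>] card_fibres w UW by auto
      then obtain V where V: "V \<in> \<F>" "U \<noteq> V" "V \<noteq> W" by blast
      have "c *\<^sub>R (D U ** M ** D W) = c *\<^sub>R (D U ** (eps a ** M) ** D W)" by (simp add: P(3))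
      also have "\<dots> = (c *\<^sub>R (D U ** eps a)) ** (M ** D W)"
        by (simp add: matmul.scaleR_left matrix_mul_assoc)
      also have "\<dots> = (D U ** M ** D V ** M ** D U) ** (M ** D W)" using c UW V by simp
      also have "\<dots> = D U ** M ** (D V ** M ** D U ** M ** D W)" by (simp only: matrix_mul_assoc)
      also have "\<dots> = k *\<^sub>R (D U ** M ** (D V ** M ** D W))"
        using k_prod[of V U W] UW V by (simp add: matmul.scaleR_right)
      also have "D U ** M ** (D V ** M ** D W) = D U ** M ** D V ** M ** D W"
        by (simp only: matrix_mul_assoc)
      finally show "c *\<^sub>R (D U ** M ** D W) = (k * k) *\<^sub>R (D U ** M ** D W)"
        using k_prod[of U V W] UW V by simp
    qed
    have r: "real (w - 1) = real w - 1" "real (w - 2) = real w - 2" using w by auto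
    \<comment> \<open>The discriminant of the quadratic: \<open>(1 - 2 * \<alpha>)\<^sup>2 + 4 *
      (\<alpha> - \<alpha>\<^sup>2) = 1\<close>.\<close>
    have "(real w * k)\<^sup>2 = (real (w - 2) * k)\<^sup>2 + 4 * (real (w - 1) * c)"
      unfolding r eq3 by (simp add: power2_eq_square algebra_simps)
    also have "\<dots> = 1" unfolding eq1 eq2 by (simp add: power2_eq_square algebra_simps)
    finally have "real w * k = 1 \<or> real w * k = - 1" by (simp add: power2_eq_1_iff)
    then have "k = 1 / real w \<or> k = - (1 / real w)" using w by (auto simp: field_simps)
    moreover have "al a = (1 - (real w - 2) * k) / 2" using eq2 unfolding r \<alpha>_def by simp
    ultimately have "al a = (1 - (real w - 2) * (1 / real w)) / 2
        \<or> al a = (1 - (real w - 2) * (- (1 / real w))) / 2" by blast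
    moreover have "(1 - (real w - 2) * (1 / real w)) / 2 = 1 / real w"
      "(1 - (real w - 2) * (- (1 / real w))) / 2 = 1 - 1 / real w"
      using w by (simp_all add: field_simps)
    ultimately show ?thesis by (simp only:)
  qed
qed

text \<open>If the fibres are not given by \<open>E\<^sub>0 + E\<^sub>d\<close>, the bound on class sizes leaves only \<open>d = 3\<close>.
  Comparing \<open>\<Sum> E\<^sub>3 E\<^sub>1\<^sup>2 = 0\<close> with the Krein inequality \<open>\<Sum> E\<^sub>3\<^sup>3 \<ge> 0\<close> (entrywise
  products) then forces \<open>n = 2\<close>, and \<open>E\<^sub>3\<close> has rank one.\<close>

lemma uniform_three_class_fibre_size:
  assumes "d = 3" "real n *\<^sub>R (E 0 + E 2) = F" "al 1 = 1 - 1 / real w" "w > 2"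
    and class1: "{h. h \<le> d \<and> sim h 1} = {1, 3}" and "triple 3 1 1 = 0"
  shows "n = 2" and "E 3 $ x $ x = 1 / real CARD('a)"
proof -
  have al3: "al 3 = 1 / real w"
    using sum_al[of 1] assms by (simp add: class1)
  have "sim 3 1" using class1 by blast
  have eps1: "eps 1 = E 1 + E 3" using class1 by (simp add: eps_def)
  have "mat 1 = E 0 + E 1 + E 2 + E 3"
    using sum_E assms(1) by (simp add: numeral_3_eq_3 numeral_2_eq_2)
  then have eps: "eps 1 = mat 1 - (1 / real n) *\<^sub>R F"
    unfolding eps1 assms(2)[symmetric] using n_gt_1 by simp
  define e where "e x y = eps 1 $ x $ y" for x y
  define f where "f x y = E 3 $ x $ y" for x y
  have E1: "E 1 $ x $ y = e x y - f x y" for x y unfolding e_def f_def eps1 by simp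
  have bd3: "bd (E 3) = (1 / real w) *\<^sub>R eps 1"
    using bd_E[of 3] eps_sim[of 3 1] assms(1) \<open>sim 3 1\<close> al3 by simp
  have e_F: "e x y = (if x = y then 1 else 0) - F $ x $ y / real n" for x y
    unfolding e_def eps by (simp add: mat_def)
  have F01: "F $ x $ y = 0 \<or> F $ x $ y = 1" for x y by (simp add: same_fibre_matrix_def)
  have F_diag: "F $ x $ x = 1" for x
    using fibre_exists[of x] F_nth by metis
  have bd3_nth: "f x y * F $ x $ y = e x y / real w" for x y
    using arg_cong[OF bd3, of "\<lambda>M. M $ x $ y"] by (simp add: bd_def f_def e_def)
  \<comment> \<open>Between fibres \<open>e\<close> vanishes and \<open>E 1\<close> is the negative
    of \<open>E 3\<close>; within a fibre \<open>f = e / w\<close>. The correction term is the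
    difference of the cubes in the second case.\<close>
  have cube: "(f x y) ^ 3 = f x y * (E 1 $ x $ y)\<^sup>2 + (e x y) ^ 3 * ((2 / real w - 1) / real w)" for x y
    using F01[of x y]
  proof
    assume 0: "F $ x $ y = 0"
    then have "e x y = 0" using F_diag[of x] e_F[of x y] by (cases "x = y") auto
    then show ?thesis unfolding E1 by (simp add: power2_eq_square power3_eq_cube)
  next
    assume "F $ x $ y = 1"
    then have "f x y = e x y / real w" using bd3_nth[of x y] by simp
    then show ?thesis unfolding E1 using assms(4)
      by (simp only:) (simp add: power2_eq_square power3_eq_cube field_simps)
  qed
  let ?S = "\<Sum>x\<in>UNIV. \<Sum>y\<in>UNIV. (e x y) ^ 3"
  have "0 \<le> (\<Sum>x\<in>UNIV. \<Sum>y\<in>UNIV. (f x y) ^ 3)"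
    unfolding f_def using assms(1)
    by (intro sum_cubes_idempotent_nonneg E_idem transpose_E) simp_all
  also have "\<dots> = (\<Sum>x\<in>UNIV. \<Sum>y\<in>UNIV. f x y * (E 1 $ x $ y)\<^sup>2) + ?S * ((2 / real w - 1) / real w)"
    by (simp only: cube sum.distrib sum_distrib_right)
  also have "(\<Sum>x\<in>UNIV. \<Sum>y\<in>UNIV. f x y * (E 1 $ x $ y)\<^sup>2) = triple 3 1 1"
    by (simp add: triple_def inner_schur_product f_def power2_eq_square mult.assoc)
  finally have "0 \<le> ?S * ((2 / real w - 1) / real w)" using assms(6) by simp
  moreover have "(2 / real w - 1) / real w < 0" using assms(4) by (simp add: field_simps)
  ultimately have S: "?S \<le> 0" by (meson mult_pos_neg not_le)
  \<comment> \<open>On a fibre \<open>e\<close> is the identity minus the all-ones matrix over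
    \<open>n\<close>; the row sum of cubes is positive unless \<open>n = 2\<close>.\<close>
  have row: "(\<Sum>y\<in>UNIV. (e x y) ^ 3) = (real n - 1) * (real n - 2) / (real n)\<^sup>2" for x
  proof -
    obtain U where U: "U \<in> \<F>" "x \<in> U" by (rule fibre_exists)
    have F_U: "F $ x $ y = (if y \<in> U then 1 else 0)" for y
      using F_nth[OF U(1) _ U(2)] by (metis fibre_exists fibre_unique U(1))
    have "(\<Sum>y\<in>UNIV. (e x y) ^ 3) = (\<Sum>y\<in>U. (e x y) ^ 3)"
      using U by (intro sum.mono_neutral_right) (auto simp: e_F F_U)
    also have "\<dots> = (e x x) ^ 3 + (\<Sum>y\<in>U - {x}. (e x y) ^ 3)"
      using U by (intro sum.remove) auto
    also have "(\<Sum>y\<in>U - {x}. (e x y) ^ 3) = (\<Sum>y\<in>U - {x}. (- 1 / real n) ^ 3)"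
      by (intro sum.cong) (auto simp: e_F F_U)
    also have "\<dots> = (real n - 1) * (- 1 / real n) ^ 3"
      using U card_fibre n_gt_1 by (simp add: of_nat_diff)
    also have "e x x = 1 - 1 / real n" by (simp add: e_F F_diag)
    finally have "(\<Sum>y\<in>UNIV. (e x y) ^ 3) = (1 - 1 / real n) ^ 3 + (real n - 1) * (- 1 / real n) ^ 3" .
    also have "\<dots> = (real n - 1) * (real n - 2) / (real n)\<^sup>2"
      using n_gt_1 by (simp add: power2_eq_square power3_eq_cube field_simps)
    finally show ?thesis .
  qed
  show n2: "n = 2"
  proof (rule ccontr)
    assume "n \<noteq> 2"
    then have "real n > 2" using n_gt_1 by simp
    then have "(real n - 1) * (real n - 2) / (real n)\<^sup>2 > 0" by simp
    then have "?S > 0" unfolding row by (intro sum_pos) simp_all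
    then show False using S by simp
  qed
  show "E 3 $ x $ x = 1 / real CARD('a)"
    using bd3_nth[of x x] F_diag[of x] e_F[of x x] n2 card_points by (simp add: f_def)
qed

lemma uniform_Q_antipodal:
  assumes Qpoly: "Q_polynomial_ordering d R E" shows "Q_antipodal d R"
proof -
  obtain j where j: "0 < j" "j \<le> d" "real n *\<^sub>R (E 0 + E j) = F"
    by (rule uniform_antipodal_index)
  note pos = Q_polynomial_triple(2)[OF Qpoly]
  show ?thesis
  proof (cases "j = d")
    case True
    then show ?thesis using Qpoly system j unfolding Q_antipodal_def by blast
  next
    case False
    then have "j < d" using j by simp
    have sim0: "sim h 0 \<longleftrightarrow> h = 0 \<or> h = j" if "h \<le> d" for h
    proof -
      have "bd (E 0) = (1 / real CARD('a)) *\<^sub>R F" by (simp add: bd_def vec_eq_iff E_0_nth)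
      then have "bd (E 0) = (real n / real CARD('a)) *\<^sub>R (E 0 + E j)"
        unfolding j(3)[symmetric] by simp
      then show ?thesis
        using sim_iff_ev[OF that, of 0] that j n_gt_1 by (simp add: ev_linear ev_E)
    qed
    \<comment> \<open>Otherwise \<open>2 * j\<close> is similar to \<open>j\<close> and so to 0,
      whose class is only \<open>{0, j}\<close>.\<close>
    have "d < 2 * j"
    proof (rule ccontr)
      assume "\<not> d < 2 * j"
      then have "triple (2 * j) j j > 0" "2 * j \<le> d" using pos[of j j] by (simp_all add: mult_2)
      then have "sim (2 * j) j" using triple_sim[OF j(3), of "2 * j" j] j by simp
      then have "sim (2 * j) 0" using sim_trans[of "2 * j" j 0] sim0[of j] j \<open>2 * j \<le> d\<close> by simp
      then show False using sim0[of "2 * j"] \<open>2 * j \<le> d\<close> j by simp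
    qed
    have up: "sim (j + 1) 1"
    proof -
      have "triple (j + 1) j 1 > 0" using pos[of j 1] \<open>j < d\<close> by simp
      then have "triple (j + 1) 1 j > 0" using triple_sym(1)[of "j + 1" j 1] by simp
      then show ?thesis using triple_sim[OF j(3), of "j + 1" 1] j \<open>j < d\<close> by simp
    qed
    \<comment> \<open>For \<open>j \<ge> 3\<close> the indices \<open>1\<close>,
      \<open>j - 1\<close> and \<open>j + 1\<close> would be three distinct members of one class;
      \<open>j = 1\<close> is excluded by \<open>j < d < 2 * j\<close>.\<close>
    have "j = 2"
    proof (rule ccontr)
      assume "j \<noteq> 2"
      then have "j \<ge> 3" using \<open>d < 2 * j\<close> \<open>j < d\<close> by simp
      have "triple j (j - 1) 1 > 0" using pos[of "j - 1" 1] j \<open>j \<ge> 3\<close> by simp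
      then have "triple (j - 1) 1 j > 0"
        using triple_sym(2)[of j "j - 1" 1] triple_sym(1)[of "j - 1" j 1] by simp
      then have "sim (j - 1) 1" using triple_sim[OF j(3), of "j - 1" 1] j \<open>j \<ge> 3\<close> by simp
      moreover have "1 \<le> d" "j - 1 \<le> d" "j + 1 \<le> d" using \<open>j < d\<close> by simp_all
      ultimately have "1 = j - 1 \<or> 1 = j + 1 \<or> j - 1 = j + 1" using uniform_class_size up by blast
      then show False using \<open>j \<ge> 3\<close> by arith
    qed
    then have d3: "d = 3" using \<open>d < 2 * j\<close> \<open>j < d\<close> by simp
    note F2 = j(3)[unfolded \<open>j = 2\<close>]
    have "sim 3 1" using up by (simp add: \<open>j = 2\<close> numeral_3_eq_3)
    have not0: "\<not> sim 1 0" using sim0[of 1] d3 \<open>j = 2\<close> by simp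
    have "\<not> sim 0 1" using not0 sim_sym[of 0 1] d3 by auto
    moreover have "\<not> sim 2 1"
    proof
      assume "sim 2 1"
      then have "sim 1 2" using sim_sym[of 2 1] d3 by simp
      then show False using sim_trans[of 1 2 0] sim0[of 2] not0 d3 \<open>j = 2\<close> by simp
    qed
    moreover have "h = 0 \<or> h = 1 \<or> h = 2 \<or> h = 3" if "h \<le> d" for h using that d3 by linarith
    ultimately have class1: "{h. h \<le> d \<and> sim h 1} = {1, 3}"
      using \<open>sim 3 1\<close> sim_refl[of 1] d3 by auto
    \<comment> \<open>Positivity of this Krein parameter selects the larger of the two possible
      values of \<open>al 1\<close> and excludes \<open>w = 2\<close>, where they coincide.\<close>
    have "triple 2 1 1 > 0" using pos[of 1 1] d3 by (simp add: numeral_2_eq_2)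
    then have "triple 1 1 2 > 0" using triple_sym(2)[of 2 1 1] triple_sym(1)[of 1 2 1] by simp
    then have "mult_of 1 * (al 1 - 1 / real w) / real n > 0"
      using triple_al[OF F2, of 1] d3 by simp
    then have gt: "al 1 > 1 / real w"
      using mult_pos[of 1] d3 n_gt_1 by (simp add: zero_less_mult_iff zero_less_divide_iff)
    then have al1: "al 1 = 1 - 1 / real w"
      using uniform_pair_al[of 1 3] \<open>sim 3 1\<close> d3 by auto
    have "w > 2" using gt al1 w_gt_1 by (cases "w = 2") auto
    have "triple 3 1 1 = 0" using Q_polynomial_triple(1)[OF Qpoly, of 3 1 1] d3 by simp
    note small = uniform_three_class_fibre_size[OF d3 F2 al1 \<open>w > 2\<close> class1 this]
    have "CARD('a) > 2" using card_points small(1) \<open>w > 2\<close> by simp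
    \<comment> \<open>The system changes here: the new one comes from the signs of
      \<open>E 3\<close> and has two fibres, with the ordering \<open>E\<close> kept.\<close>
    then have "\<exists>w n \<F> \<I>. imprimitivity_system d R w n \<F> \<I> \<and>
        real n *\<^sub>R (E 0 + E d) = same_fibre_matrix \<F>"
      using small(2) d3 by (intro rank_one_imprimitive) simp_all
    then show ?thesis using Qpoly unfolding Q_antipodal_def by blast
  qed
qed

end

end

theorem theorem5p1:
  fixes d :: nat and R :: "nat \<Rightarrow> ('x::finite \<times> 'x) set"
  assumes "assoc_scheme d R"
    and "cometric d R"
  shows "uniform_scheme d R \<longleftrightarrow> Q_antipodal d R"
proof
  assume "uniform_scheme d R"
  then obtain w n \<F> \<I> where sys: "imprimitivity_system d R w n \<F> \<I>" "uniform_wrt d R \<F> \<I>"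
    unfolding uniform_scheme_def by blast
  \<comment> \<open>The ordering is taken from \<open>cometric\<close> independently of the uniform
    system; \<open>uniform_Q_antipodal\<close> accepts any such pair.\<close>
  obtain E where E: "Q_polynomial_ordering d R E" using assms(2) unfolding cometric_def by blast
  interpret fibred_scheme d R E w n \<F> \<I>
    using assms(1) sys(1) E by unfold_locales (auto simp: Q_polynomial_ordering_def)
  show "Q_antipodal d R" using uniform_Q_antipodal[OF sys(2) E] .
next
  assume "Q_antipodal d R"
  then obtain E w n \<F> \<I> where E: "Q_polynomial_ordering d R E"
    and sys: "imprimitivity_system d R w n \<F> \<I>"
    and antipodal: "real n *\<^sub>R (E 0 + E d) = same_fibre_matrix \<F>"
    unfolding Q_antipodal_def by blast
  interpret fibred_scheme d R E w n \<F> \<I>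
    using assms(1) sys E by unfold_locales (auto simp: Q_polynomial_ordering_def)
  show "uniform_scheme d R"
    unfolding uniform_scheme_def using antipodal_uniform[OF E antipodal] sys by blast
qed

end
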